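(* Let $\gamma\in H$. Suppose $f$ is a solution of the interior Riemann–Hilbert problem, i.e.: - $f$ is analytic in $G$ with $f(\infty)=0$; - $f$ is continuous on $G\cup\Gamma$; - $\operatorname{Re}[Af^+]=\gamma$ on $\Gamma$. Write its boundary values as $Af^+=\gamma+i\mu$ with $\mu$ real. Then $\mu$ satisfies the integral equation \[ \mu-\mathbf N\mu=-\mathbf M\gamma . \]
   Context: $G$ is an unbounded multiply connected region of connectivity $m$ with $\infty\in G$ and $0\in G$. Its boundary is $\Gamma=\Gamma_1\cup\dots\cup\Gamma_m$, consisting of simple, non-intersecting, smooth, clockwise oriented closed curves, so that $G$ lies to the left of $\Gamma$. Each $\Gamma_k$ is parametrized by a $2\pi$-periodic, twice continuously differentiable function $\eta_k$ with $\dot\eta_k\ne0$. $J$ is the disjoint union of $J_k=[0,2\pi]$, and $\eta=\eta_k$ on $J_k$. $H$ is the space of real functions on $J$ that are Hölder continuous and $2\pi$-periodic on each $J_k$. Functions on $\Gamma$ are identified with functions on $J$ via $\eta$. $f^+$ denotes the boundary value of $f$ from $G$, assumed Hölder continuous. $A$ is a nonvanishing complex function on $\Gamma$ whose parametric form $A(t)$ is continuously differentiable on $J$. The real kernels are given by \[ M(s,t)+iN(s,t):=\frac1\pi\frac{A(s)}{A(t)}\frac{\dot\eta(t)}{\eta(t)-\eta(s)} , \] where $N$ is the generalized Neumann kernel. The operators are $\mathbf N\mu(s)=\int_J N(s,t)\mu(t)\,dt$ and $\mathbf M\mu(s)=\int_J M(s,t)\mu(t)\,dt$, the latter a principal value integral.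 *)

theory Defs
  imports "HOL-Complex_Analysis.Complex_Analysis"
begin

definition holder_on :: "real set \<Rightarrow> (real \<Rightarrow> 'a::real_normed_vector) \<Rightarrow> bool" where
  "holder_on S g \<longleftrightarrow> (\<exists>\<alpha> C. 0 < \<alpha> \<and> \<alpha> \<le> 1 \<and>
      (\<forall>s\<in>S. \<forall>t\<in>S. norm (g s - g t) \<le> C * \<bar>s - t\<bar> powr \<alpha>))"

text \<open>The space H (restricted to one component J_k): Hoelder continuous, 2pi-periodic.\<close>
definition in_H :: "(real \<Rightarrow> real) \<Rightarrow> bool" where
  "in_H g \<longleftrightarrow> holder_on {0..2*pi} g \<and> (\<forall>t. g (t + 2*pi) = g t)"

definition C2_fun :: "(real \<Rightarrow> complex) \<Rightarrow> bool" where
  "C2_fun g \<longleftrightarrow> (\<exists>g1 g2. (\<forall>t. (g has_vector_derivative g1 t) (at t)) \<and>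
      (\<forall>t. (g1 has_vector_derivative g2 t) (at t)) \<and> continuous_on UNIV g2)"

definition C1_fun :: "(real \<Rightarrow> complex) \<Rightarrow> bool" where
  "C1_fun g \<longleftrightarrow> (\<exists>g1. (\<forall>t. (g has_vector_derivative g1 t) (at t)) \<and> continuous_on UNIV g1)"

definition bpath :: "(real \<Rightarrow> complex) \<Rightarrow> real \<Rightarrow> complex" where
  "bpath g = (\<lambda>x. g (2 * pi * x))"

text \<open>The complex kernel M(s,t) + i N(s,t), for s in J_j and t in J_k.
  Here Af is the function A on Gamma, so A(t) = Af (eta k t).\<close>
definition kernel :: "(complex \<Rightarrow> complex) \<Rightarrow> (nat \<Rightarrow> real \<Rightarrow> complex)
                      \<Rightarrow> nat \<Rightarrow> real \<Rightarrow> nat \<Rightarrow> real \<Rightarrow> complex" where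
  "kernel Af \<eta> j s k t =
     complex_of_real (1 / pi) * (Af (\<eta> j s) / Af (\<eta> k t)) *
     (vector_derivative (\<eta> k) (at t) / (\<eta> k t - \<eta> j s))"

definition Mker where "Mker Af \<eta> j s k t = Re (kernel Af \<eta> j s k t)"
definition Nker where "Nker Af \<eta> j s k t = Im (kernel Af \<eta> j s k t)"

definition Nop :: "nat \<Rightarrow> (complex \<Rightarrow> complex) \<Rightarrow> (nat \<Rightarrow> real \<Rightarrow> complex)
                   \<Rightarrow> (nat \<Rightarrow> real \<Rightarrow> real) \<Rightarrow> nat \<Rightarrow> real \<Rightarrow> real" where
  "Nop m Af \<eta> \<mu> j s = (\<Sum>k<m. integral {0..2*pi} (\<lambda>t. Nker Af \<eta> j s k t * \<mu> k t))"

text \<open>Truncated integral for the principal value of M mu (s), s in J_j: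
  by periodicity we integrate over [s - pi, s + pi] and remove (s - eps, s + eps).\<close>
definition Mtrunc :: "nat \<Rightarrow> (complex \<Rightarrow> complex) \<Rightarrow> (nat \<Rightarrow> real \<Rightarrow> complex)
                   \<Rightarrow> (nat \<Rightarrow> real \<Rightarrow> real) \<Rightarrow> nat \<Rightarrow> real \<Rightarrow> real \<Rightarrow> real" where
  "Mtrunc m Af \<eta> \<mu> j s \<epsilon> = (\<Sum>k<m. integral ({s - pi..s - \<epsilon>} \<union> {s + \<epsilon>..s + pi})
        (\<lambda>t. Mker Af \<eta> j s k t * \<mu> k t))"

definition Mop_pv :: "nat \<Rightarrow> (complex \<Rightarrow> complex) \<Rightarrow> (nat \<Rightarrow> real \<Rightarrow> complex)
                   \<Rightarrow> (nat \<Rightarrow> real \<Rightarrow> real) \<Rightarrow> nat \<Rightarrow> real \<Rightarrow> real \<Rightarrow> bool" where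
  "Mop_pv m Af \<eta> \<mu> j s v \<longleftrightarrow> ((Mtrunc m Af \<eta> \<mu> j s) \<longlongrightarrow> v) (at_right 0)"

end

theory Submission
  imports Defs "HOL-Library.Periodic_Fun"
begin

text \<open>
  Multiplying the kernel by \<open>\<gamma> + i\<mu> = A f\<close> turns it into \<open>A(s) / \<pi>\<close> times the Cauchy kernel
  applied to \<open>f\<close>, so the integral equation is the real part of the Plemelj formula: the principal
  value of the integral of \<open>f(w) / (w - z)\<close> over the boundary is \<open>\<pi> i f(z)\<close> for \<open>z\<close> on the boundary.

  To obtain that formula, fix \<open>z = \<eta>(s)\<close> and consider the two points \<open>\<eta>(s) \<plusminus> i r \<eta>'(s)\<close>. For small
  \<open>r\<close> one lies in \<open>G\<close> and the other in the hole bounded by the curve, so the Cauchy integrals of \<open>f\<close>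
  at these points add up to \<open>2 \<pi> i\<close> times a value of \<open>f\<close> near \<open>z\<close>. In the sum the singular parts
  of the two kernels cancel by symmetry up to a dominated remainder, and \<open>r \<rightarrow> 0\<close> gives twice the
  principal value.

  Since \<open>f\<close> is only continuous up to the boundary, Cauchy's theorem is applied to the curves
  \<open>\<eta> \<plusminus> i \<delta> \<eta>'\<close> pushed into \<open>G\<close>. That they lie in \<open>G\<close> and have the right winding numbers follows
  from the Jordan curve theorem, because every point close to a boundary curve lies on the normal at
  its nearest point and hence in one of the two connected collars of the curve.
\<close>

section \<open>Cauchy's theorem for several loops\<close>

text \<open>The two Cauchy integrals are added instead of being treated by a jump relation: their
  sum is symmetric in the sign of \<open>r\<close>, so it never has to be decided which of the
  normals \<open>i \<eta>'\<close> and \<open>- i \<eta>'\<close> points into \<open>G\<close>. Only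
  the existence of a sign \<open>\<sigma> k\<close> is used; it comes from connectedness, and
  orientation enters solely through winding numbers. The normal is not normalised: a pushed curve
  then has the derivative \<open>\<eta>' \<plusminus> i \<delta> \<eta>''\<close>, which is
  continuous because \<open>\<eta>\<close> is twice continuously differentiable. Two kinds of
  regularity are at work. Continuity up to the boundary carries Cauchy's theorem to the boundary,
  whereas the Hoelder bound makes the symmetrised kernel dominated by
  \<open>\<bar>t - s\<bar> powr (\<alpha> - 1)\<close> up to constants. The signs of the equation
  arise as follows: the real part of \<open>(M + i N) (\<gamma> + i \<mu>)\<close> is
  \<open>M \<gamma> - N \<mu>\<close>, and the real part of
  \<open>(A(s) / \<pi>) (\<pi> i f) = i (\<gamma> + i \<mu>)\<close> is
  \<open>- \<mu>\<close>.\<close>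

lemma joined_loop_exists:
  assumes S: "open S" "connected S" "a \<in> S" and "finite I"
    and "\<And>i. i \<in> I \<Longrightarrow> valid_path (p i) \<and> pathfinish (p i) = pathstart (p i) \<and> path_image (p i) \<subseteq> S"
  shows "\<exists>g. valid_path g \<and> pathstart g = a \<and> pathfinish g = a \<and> path_image g \<subseteq> S \<and>
           (\<forall>f. f holomorphic_on S \<longrightarrow> contour_integral g f = (\<Sum>i\<in>I. contour_integral (p i) f))"
  using assms(4,5)
proof (induction I)
  case empty
  show ?case
    using S by (intro exI[of _ "linepath a a"] conjI) (auto simp del: linepath_refl linepath_trivial)
next
  case (insert i I)
  then obtain g where g: "valid_path g" "pathstart g = a" "pathfinish g = a" "path_image g \<subseteq> S"
    and gint: "\<And>f. f holomorphic_on S \<Longrightarrow> contour_integral g f = (\<Sum>i\<in>I. contour_integral (p i) f)"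
    by (metis insertI2)
  have pi: "valid_path (p i)" "pathfinish (p i) = pathstart (p i)" "path_image (p i) \<subseteq> S"
    using insert.prems by auto
  then have "pathstart (p i) \<in> S"
    by (meson pathstart_in_path_image subsetD)
  then obtain c where c: "polynomial_function c" "path_image c \<subseteq> S" "pathstart c = a"
      "pathfinish c = pathstart (p i)"
    using connected_open_polynomial_connected[OF S] by blast
  then have vc: "valid_path c"
    by (simp add: valid_path_polynomial_function)
  \<comment> \<open>A detour from the base point to the new loop and back: the integrals along
    \<open>c\<close> and \<open>reversepath c\<close> cancel, so only the loop itself is
    added.\<close>
  define h where "h = (c +++ p i +++ reversepath c) +++ g"
  have "contour_integral h f = (\<Sum>i\<in>insert i I. contour_integral (p i) f)"
    if f: "f holomorphic_on S" for f
  proof -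
    have "f contour_integrable_on c" "f contour_integrable_on p i" "f contour_integrable_on g"
      using f S vc c pi g by (auto intro: contour_integrable_holomorphic_simple)
    then show ?thesis
      using vc c pi g gint[OF f] insert.hyps
      by (simp add: h_def contour_integral_join contour_integrable_join contour_integral_reversepath
          contour_integrable_reversepath valid_path_join)
  qed
  moreover have "path_image h \<subseteq> S"
    unfolding h_def using c pi g by (intro subset_path_image_join) auto
  ultimately show ?case
    using vc c pi g by (intro exI[of _ h]) (auto simp: h_def valid_path_join)
qed

text \<open>The loops are joined by arcs in \<open>S\<close> to one closed path with the same
  integrals. For \<open>w\<close> outside \<open>S\<close> the function \<open>1 / (v - w)\<close>
  is holomorphic on \<open>S\<close>, so the winding numbers add up as well, and the homological
  Cauchy theorem for a single path applies.\<close>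

lemma Cauchy_theorem_loops:
  assumes S: "open S" "connected S" and "finite I"
    and p: "\<And>i. i \<in> I \<Longrightarrow> valid_path (p i) \<and> pathfinish (p i) = pathstart (p i) \<and> path_image (p i) \<subseteq> S"
    and wn: "\<And>w. w \<notin> S \<Longrightarrow> (\<Sum>i\<in>I. winding_number (p i) w) = 0"
    and f: "f holomorphic_on S"
  shows "(\<Sum>i\<in>I. contour_integral (p i) f) = 0"
proof (cases "S = {}")
  case True
  then have "I = {}" using p by auto
  then show ?thesis by simp
next
  case False
  then obtain a where a: "a \<in> S" by blast
  have "\<exists>g. valid_path g \<and> pathstart g = a \<and> pathfinish g = a \<and> path_image g \<subseteq> S \<and>
           (\<forall>f. f holomorphic_on S \<longrightarrow> contour_integral g f = (\<Sum>i\<in>I. contour_integral (p i) f))"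
    by (rule joined_loop_exists[OF S a \<open>finite I\<close> p])
  then obtain g where g: "valid_path g" "pathstart g = a" "pathfinish g = a" "path_image g \<subseteq> S"
    and gint: "\<forall>f. f holomorphic_on S \<longrightarrow> contour_integral g f = (\<Sum>i\<in>I. contour_integral (p i) f)"
    by (elim exE conjE)
  have "winding_number g w = 0" if w: "w \<notin> S" for w
  proof -
    have vp: "winding_number q w = 1 / (2 * of_real pi * \<i>) * contour_integral q (\<lambda>v. 1 / (v - w))"
      if "valid_path q" "path_image q \<subseteq> S" for q
      using that w by (subst winding_number_valid_path) auto
    have "winding_number g w = 1 / (2 * of_real pi * \<i>) * contour_integral g (\<lambda>v. 1 / (v - w))"
      using g by (intro vp) auto
    also have "contour_integral g (\<lambda>v. 1 / (v - w)) = (\<Sum>i\<in>I. contour_integral (p i) (\<lambda>v. 1 / (v - w)))"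
      using w by (intro gint[rule_format] holomorphic_intros) auto
    also have "1 / (2 * of_real pi * \<i>) * \<dots> = (\<Sum>i\<in>I. winding_number (p i) w)"
      unfolding sum_distrib_left using p by (intro sum.cong refl vp[symmetric]) auto
    finally show ?thesis using wn w by simp
  qed
  then have "(f has_contour_integral 0) g"
    using Cauchy_theorem_global[OF S(1) f g(1) _ g(4)] g(2,3) by simp
  then show ?thesis
    using gint[rule_format, OF f] by (simp add: contour_integral_unique)
qed

section \<open>Integrals over real intervals\<close>

lemma has_integral_shift_real:
  fixes f :: "real \<Rightarrow> 'a::euclidean_space"
  assumes "(f has_integral I) {a..b}"
  shows "((\<lambda>t. f (t + c)) has_integral I) {a - c..b - c}"
  using has_integral_affinity'[of f I a b 1 c] assms by simp

lemma has_integral_reflect_about: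
  fixes f :: "real \<Rightarrow> 'a::euclidean_space"
  assumes "(f has_integral I) {s + a..s + b}"
  shows "((\<lambda>t. f (2 * s - t)) has_integral I) {s - b..s - a}"
proof -
  have "(f has_integral I) {- (- s - a)..- (- s - b)}"
    using assms by (simp add: add.commute)
  then have "((\<lambda>t. f (- t)) has_integral I) {- s - b..- s - a}"
    using has_integral_reflect_real[of "\<lambda>t. f (- t)" I "- s - a" "- s - b"] by simp
  from has_integral_shift_real[OF this, of "- 2 * s"] show ?thesis
    by (simp add: algebra_simps)
qed

lemma integral_odd_about:
  fixes f :: "real \<Rightarrow> 'a::euclidean_space"
  assumes odd: "\<And>t. f (2 * s - t) = - f t"
    and int: "f integrable_on {s + a..s + b}"
  shows "f integrable_on {s - b..s - a}"
    and "integral {s - b..s - a} f + integral {s + a..s + b} f = 0"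
proof -
  have "((\<lambda>t. - f t) has_integral integral {s + a..s + b} f) {s - b..s - a}"
    using has_integral_reflect_about[OF integrable_integral[OF int]] by (simp add: odd)
  from has_integral_neg[OF this]
  have "(f has_integral - integral {s + a..s + b} f) {s - b..s - a}"
    by simp
  then show "f integrable_on {s - b..s - a}"
    "integral {s - b..s - a} f + integral {s + a..s + b} f = 0"
    by (auto simp: integral_unique)
qed

lemma has_integral_periodic:
  fixes f :: "real \<Rightarrow> 'a::euclidean_space"
  assumes per: "\<And>t. f (t + p) = f t" and int: "f integrable_on {a..a + p}" and b: "a \<le> b" "b \<le> a + p"
  shows "(f has_integral integral {a..a + p} f) {b..b + p}"
proof -
  have "f integrable_on {a..b}" "f integrable_on {b..a + p}"
    using int b by (auto intro: integrable_on_subinterval)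
  then obtain I J where I: "(f has_integral I) {a..b}" and J: "(f has_integral J) {b..a + p}"
    by (auto simp: integrable_on_def)
  have "(f has_integral I) {a + p..b + p}"
    using has_integral_shift_real[OF I, of "- p"] per[of "_ - p"] by simp
  then have "(f has_integral J + I) {b..b + p}"
    using has_integral_combine[OF _ _ J, of "b + p" I] b by simp
  moreover have "(f has_integral I + J) {a..a + p}"
    using has_integral_combine[OF b I J] .
  ultimately show ?thesis
    by (simp add: integral_unique add.commute)
qed

text \<open>Recentring puts the singularity \<open>t = s\<close> in the middle of the window, where
  the reflection of \<open>t\<close> in \<open>s\<close> acts. It also reconciles
  \<open>Nop\<close>, which integrates over [0, 2 pi], with the centred window of
  \<open>Mtrunc\<close>.\<close>

lemma integral_centered_period:
  fixes f :: "real \<Rightarrow> 'a::euclidean_space"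
  assumes per: "\<And>t. f (t + 2 * pi) = f t" and s: "s \<in> {0..2 * pi}"
    and int: "f integrable_on {s - pi..s + pi}"
  shows "f integrable_on {0..2 * pi}" "integral {0..2 * pi} f = integral {s - pi..s + pi} f"
proof -
  have "(f has_integral integral {s - pi..s + pi} f) {0..2 * pi}"
  \<comment> \<open>For \<open>s \<le> pi\<close> the point \<open>0\<close> lies in the window and
    can start the new period. Otherwise \<open>2 * pi\<close> does, and the integral over
    [2 pi, 4 pi] is shifted back.\<close>
  proof (cases "s \<le> pi")
    case True
    then show ?thesis
      using has_integral_periodic[where f = f and p = "2 * pi", OF per, of "s - pi" 0] int s by (simp add: add_ac)
  next
    case False
    have "(f has_integral integral {s - pi..s + pi} f) {2 * pi..2 * pi + 2 * pi}"
      using has_integral_periodic[where f = f and p = "2 * pi", OF per, of "s - pi" "2 * pi"] int s False by (simp add: add_ac)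
    from has_integral_shift_real[OF this, of "2 * pi"] show ?thesis
      by (simp add: per)
  qed
  then show "f integrable_on {0..2 * pi}" "integral {0..2 * pi} f = integral {s - pi..s + pi} f"
    by (auto simp: integral_unique)
qed

lemma integral_punctured:
  fixes f :: "real \<Rightarrow> 'a::euclidean_space"
  assumes "e > 0" "f integrable_on {s - b..s - e}" "f integrable_on {s + e..s + b}"
  shows "integral ({s - b..s - e} \<union> {s + e..s + b}) f
           = integral {s - b..s - e} f + integral {s + e..s + b} f"
    and "f integrable_on ({s - b..s - e} \<union> {s + e..s + b})"
proof -
  have "{s - b..s - e} \<inter> {s + e..s + b} = {}" using assms by auto
  then have "(f has_integral integral {s - b..s - e} f + integral {s + e..s + b} f)
     ({s - b..s - e} \<union> {s + e..s + b})"
    using assms by (intro has_integral_Un) (auto simp: integrable_integral)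
  then show "integral ({s - b..s - e} \<union> {s + e..s + b}) f
           = integral {s - b..s - e} f + integral {s + e..s + b} f"
    and "f integrable_on ({s - b..s - e} \<union> {s + e..s + b})"
    by (auto simp: integral_unique)
qed

text \<open>By continuity of the indefinite integral at \<open>s\<close>, the principal value of an
  integrable function is its ordinary integral.\<close>

lemma integral_punctured_tendsto:
  fixes f :: "real \<Rightarrow> 'a::euclidean_space"
  assumes int: "f integrable_on {s - b..s + b}" and b: "b > 0"
  shows "((\<lambda>e. integral ({s - b..s - e} \<union> {s + e..s + b}) f) \<longlongrightarrow> integral {s - b..s + b} f) (at_right 0)"
proof -
  have ev: "\<forall>\<^sub>F e in at_right 0. 0 < e \<and> e < b"
    using b by (auto simp: eventually_at_right_field)
  have 1: "((\<lambda>x. integral {s - b..x} f) \<longlongrightarrow> integral {s - b..s} f) (at s within {s - b..s + b})"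
    using indefinite_integral_continuous_1[OF int] b by (simp add: continuous_on_def)
  have 2: "((\<lambda>x. integral {x..s + b} f) \<longlongrightarrow> integral {s..s + b} f) (at s within {s - b..s + b})"
    using indefinite_integral_continuous_1'[OF int] b by (simp add: continuous_on_def)
  have f1: "filterlim (\<lambda>e. s - e) (at s within {s - b..s + b}) (at_right 0)"
    unfolding filterlim_at
    by (intro conjI tendsto_eq_intros eventually_mono[OF ev]) auto
  have f2: "filterlim (\<lambda>e. s + e) (at s within {s - b..s + b}) (at_right 0)"
    unfolding filterlim_at
    by (intro conjI tendsto_eq_intros eventually_mono[OF ev]) auto
  have "((\<lambda>e. integral {s - b..s - e} f + integral {s + e..s + b} f) \<longlongrightarrow>
          integral {s - b..s} f + integral {s..s + b} f) (at_right 0)"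
    by (intro tendsto_add filterlim_compose[OF 1 f1] filterlim_compose[OF 2 f2])
  moreover have "integral {s - b..s} f + integral {s..s + b} f = integral {s - b..s + b} f"
    using b by (intro Henstock_Kurzweil_Integration.integral_combine int) auto
  moreover have "\<forall>\<^sub>F e in at_right 0. integral {s - b..s - e} f + integral {s + e..s + b} f
      = integral ({s - b..s - e} \<union> {s + e..s + b}) f"
    using ev by eventually_elim
      (rule integral_punctured(1)[symmetric]; auto intro: integrable_on_subinterval[OF int])
  ultimately show ?thesis
    by (auto elim: Lim_transform_eventually)
qed

text \<open>Supplies the majorant for dominated convergence: a Hoelder exponent
  \<open>\<alpha> > 0\<close> against a simple pole leaves the power
  \<open>\<alpha> - 1 > - 1\<close>.\<close>

lemma integrable_abs_powr_about:
  fixes s :: real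
  assumes "a > - 1" "b \<ge> 0"
  shows "(\<lambda>t. \<bar>t - s\<bar> powr a) integrable_on {s - b..s + b}"
proof -
  have "(\<lambda>x. x powr a) integrable_on {0..b}"
    using assms by (rule integrable_on_powr_from_0)
  then obtain I where "((\<lambda>x. x powr a) has_integral I) {0..b}"
    by (auto simp: integrable_on_def)
  then have I: "((\<lambda>x. \<bar>x\<bar> powr a) has_integral I) {0..b}"
    by (rule has_integral_eq[rotated]) auto
  have 1: "((\<lambda>t. \<bar>t - s\<bar> powr a) has_integral I) {s..s + b}"
    using has_integral_shift_real[OF I, of "- s"] by (simp add: add.commute)
  then have "((\<lambda>t. \<bar>t - s\<bar> powr a) has_integral I) {s + 0..s + b}"
    by simp
  from has_integral_reflect_about[OF this]
  have 2: "((\<lambda>t. \<bar>t - s\<bar> powr a) has_integral I) {s - b..s}"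
    by (simp add: abs_minus_commute)
  show ?thesis
    using has_integral_combine[OF _ _ 2 1] assms by (auto simp: integrable_on_def)
qed

section \<open>Regular loops in the plane\<close>

lemma valid_path_bpath:
  assumes der: "\<And>t. (q has_vector_derivative q' t) (at t)" and cont: "continuous_on UNIV q'"
  shows "valid_path (bpath q)"
proof -
  have "(bpath q has_vector_derivative (2 * pi) *\<^sub>R q' (2 * pi * x)) (at x)" for x
    unfolding bpath_def
    by (rule vector_diff_chain_at[of "\<lambda>x. 2 * pi * x" "2 * pi" x q, unfolded o_def])
       (auto intro!: derivative_eq_intros der)
  moreover have "continuous_on {0..1} (\<lambda>x. (2 * pi) *\<^sub>R q' (2 * pi * x))"
    by (intro continuous_intros continuous_on_compose2[OF cont]) auto
  ultimately have "bpath q C1_differentiable_on {0..1}"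
    unfolding C1_differentiable_on_def
    by (intro exI[of _ "\<lambda>x. (2 * pi) *\<^sub>R q' (2 * pi * x)"]) auto
  then show ?thesis
    by (simp add: valid_path_def C1_differentiable_imp_piecewise)
qed

lemma contour_integral_bpath:
  assumes der: "\<And>t. (q has_vector_derivative q' t) (at t)"
    and int: "(\<lambda>t. F (q t) * q' t) integrable_on {0..2 * pi}"
  shows "contour_integral (bpath q) F = integral {0..2 * pi} (\<lambda>t. F (q t) * q' t)"
proof -
  have vd: "vector_derivative (bpath q) (at x) = (2 * pi) *\<^sub>R q' (2 * pi * x)" for x
    unfolding bpath_def
    by (intro vector_derivative_at
        vector_diff_chain_at[of "\<lambda>x. 2 * pi * x" "2 * pi" x q, unfolded o_def])
       (auto intro!: derivative_eq_intros der)
  have "((\<lambda>x. F (q (2 * pi * x)) * q' (2 * pi * x)) has_integral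
      integral {0..2 * pi} (\<lambda>t. F (q t) * q' t) /\<^sub>R (2 * pi)) {0..1}"
    using has_integral_affinity'[of "\<lambda>t. F (q t) * q' t" _ 0 "2 * pi" "2 * pi" 0]
      integrable_integral[OF int] by simp
  from has_integral_cmul[OF this, of "2 * pi"]
  have "((\<lambda>x. F (bpath q x) * vector_derivative (bpath q) (at x)) has_integral
      integral {0..2 * pi} (\<lambda>t. F (q t) * q' t)) {0..1}"
    unfolding vd by (simp add: bpath_def mult_ac)
  then show ?thesis
    by (simp add: contour_integral_integral integral_unique)
qed

lemma path_image_bpath: "path_image (bpath q) = q ` {0..2 * pi}"
proof -
  have "(\<lambda>x. 2 * pi * x) ` {0..1} = {0..2 * pi}"
    by (simp add: image_mult_atLeastAtMost)
  then show ?thesis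
    unfolding path_image_def bpath_def by (metis image_image)
qed

lemma C1_imp_Lipschitz:
  fixes h :: "real \<Rightarrow> 'a::real_normed_vector"
  assumes der: "\<And>t. (h has_vector_derivative h' t) (at t)" and cont: "continuous_on {a..b} h'"
  obtains L where "L > 0" "\<And>s t. s \<in> {a..b} \<Longrightarrow> t \<in> {a..b} \<Longrightarrow> norm (h t - h s) \<le> L * \<bar>t - s\<bar>"
proof -
  have "compact (h' ` {a..b})"
    using cont by (intro compact_continuous_image) auto
  then obtain L where L: "L > 0" "\<And>t. t \<in> {a..b} \<Longrightarrow> norm (h' t) \<le> L"
    using compact_imp_bounded bounded_pos by (metis image_eqI)
  have "norm (h t - h s) \<le> L * \<bar>t - s\<bar>" if "s \<in> {a..b}" "t \<in> {a..b}" for s t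
  proof -
    have "norm (h t - h s) \<le> L * norm (t - s)"
    proof (rule differentiable_bound[OF convex_real_interval(5)])
      show "(h has_derivative (\<lambda>u. u *\<^sub>R h' x)) (at x within {a..b})" for x
        using der[of x] by (simp add: has_vector_derivative_def has_derivative_at_withinI)
      show "onorm (\<lambda>u. u *\<^sub>R h' x) \<le> L" if "x \<in> {a..b}" for x
      proof (rule onorm_le)
        show "norm (u *\<^sub>R h' x) \<le> L * norm u" for u
          using mult_right_mono[OF L(2)[OF that], of "\<bar>u\<bar>"] by (simp add: mult.commute)
      qed
    qed (use that in auto)
    then show ?thesis by simp
  qed
  then show thesis using that L(1) by blast
qed

text \<open>The parametrization is kept as a periodic function on the whole line, so that windows
  centred at any \<open>s\<close> are available. The derivatives are parameters because the normal
  displacement \<open>\<i> * r * g'\<close> must itself be differentiated.\<close>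

locale smooth_loop =
  fixes g g' g'' :: "real \<Rightarrow> complex"
  assumes periodic: "\<And>t. g (t + 2 * pi) = g t"
    and deriv: "\<And>t. (g has_vector_derivative g' t) (at t)"
    and deriv2: "\<And>t. (g' has_vector_derivative g'' t) (at t)"
    and cont2: "continuous_on UNIV g''"
    and regular: "\<And>t. g' t \<noteq> 0"
    and inj: "inj_on g {0..<2 * pi}"
begin

lemma cont: "continuous_on A g"
  using deriv by (meson continuous_at_imp_continuous_on has_vector_derivative_continuous)

lemma cont': "continuous_on A g'"
  using deriv2 by (meson continuous_at_imp_continuous_on has_vector_derivative_continuous)

lemma periodic': "g' (t + 2 * pi) = g' t"
proof -
  have "((\<lambda>t. g (t + 2 * pi)) has_vector_derivative g' (t + 2 * pi)) (at t)"
    using vector_diff_chain_at[of "\<lambda>x. x + 2 * pi" 1 t g "g' (t + 2 * pi)"] deriv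
    by (simp add: o_def has_vector_derivative_add_const)
  then show ?thesis
    using vector_derivative_unique_at[OF deriv] by (simp add: periodic)
qed

sublocale per: periodic_fun_simple g "2 * pi"
  by standard (rule periodic)

sublocale per': periodic_fun_simple g' "2 * pi"
  by standard (rule periodic')

lemma centered_representative:
  obtains t' where "\<bar>t' - s\<bar> \<le> pi" "g t' = g t" "g' t' = g' t"
proof -
  define n where "n = round ((t - s) / (2 * pi))"
  have "\<bar>of_int n - (t - s) / (2 * pi)\<bar> \<le> 1 / 2"
    unfolding n_def by (rule of_int_round_abs_le)
  then have "\<bar>of_int n * (2 * pi) - (t - s)\<bar> \<le> pi"
    by (simp add: field_simps abs_if split: if_splits)
  then have "\<bar>(t - of_int n * (2 * pi)) - s\<bar> \<le> pi"
    by (simp add: abs_if split: if_splits)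
  then show thesis
    using that[of "t - of_int n * (2 * pi)"] by (simp add: per.minus_of_int per'.minus_of_int)
qed

lemma base_representative:
  obtains n :: int where "t - of_int n * (2 * pi) \<in> {0..<2 * pi}"
proof -
  define n where "n = \<lfloor>t / (2 * pi)\<rfloor>"
  have "of_int n \<le> t / (2 * pi)" "t / (2 * pi) < of_int n + 1"
    unfolding n_def by linarith+
  then have "t - of_int n * (2 * pi) \<in> {0..<2 * pi}"
    by (simp add: field_simps)
  then show thesis by (rule that)
qed

lemma in_curve: "g t \<in> path_image (bpath g)"
proof -
  obtain n :: int where "t - of_int n * (2 * pi) \<in> {0..<2 * pi}"
    by (rule base_representative)
  then have "g (t - of_int n * (2 * pi)) \<in> g ` {0..2 * pi}" by auto
  then show ?thesis by (simp add: path_image_bpath per.minus_of_int)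
qed

lemma eq_imp_eq_mod:
  assumes "g s = g t"
  obtains n :: int where "t = s + of_int n * (2 * pi)"
proof -
  obtain a b :: int where a: "s - of_int a * (2 * pi) \<in> {0..<2 * pi}"
    and b: "t - of_int b * (2 * pi) \<in> {0..<2 * pi}"
    using base_representative by metis
  have "g (s - of_int a * (2 * pi)) = g (t - of_int b * (2 * pi))"
    using assms by (simp add: per.minus_of_int)
  then have "s - of_int a * (2 * pi) = t - of_int b * (2 * pi)"
    using inj_onD[OF inj] a b by blast
  then show thesis
    by (intro that[of "b - a"]) (simp add: algebra_simps)
qed

lemma eq_imp_eq:
  assumes "g s = g t" "\<bar>t - s\<bar> < 2 * pi"
  shows "s = t"
proof -
  obtain n :: int where n: "t = s + of_int n * (2 * pi)"
    using eq_imp_eq_mod assms(1) by blast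
  then have "\<bar>of_int n\<bar> * (2 * pi) < 1 * (2 * pi)"
    using assms(2) by (simp add: abs_mult)
  then have "\<bar>of_int n :: real\<bar> < 1"
    by (subst (asm) mult_less_cancel_right_pos) auto
  then show ?thesis using n by simp
qed

lemma path: "path (bpath g)" and valid_path: "valid_path (bpath g)"
  and loop: "pathfinish (bpath g) = pathstart (bpath g)"
proof -
  show "valid_path (bpath g)" using deriv cont' by (rule valid_path_bpath)
  then show "path (bpath g)" by (rule valid_path_imp_path)
  show "pathfinish (bpath g) = pathstart (bpath g)"
    using periodic[of 0] by (simp add: bpath_def pathfinish_def pathstart_def)
qed

lemma simple_path: "simple_path (bpath g)"
proof -
  have "x = y \<or> x = 0 \<and> y = 1 \<or> x = 1 \<and> y = 0"
    if "x \<in> {0..1}" "y \<in> {0..1}" "bpath g x = bpath g y" for x y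
  proof (cases "\<bar>y - x\<bar> < 1")
    case True
    then have "\<bar>2 * pi * y - 2 * pi * x\<bar> < 2 * pi"
      by (simp flip: right_diff_distrib add: abs_mult)
    then show ?thesis using eq_imp_eq[of "2 * pi * x" "2 * pi * y"] that by (simp add: bpath_def)
  next
    case False
    then show ?thesis using that by auto
  qed
  then show ?thesis
    unfolding simple_path_def loop_free_def using path by blast
qed

section \<open>Estimates along the normals of a loop\<close>

lemma taylor_bounds:
  obtains C where "C > 0"
    "\<And>s t. s \<in> {0..2 * pi} \<Longrightarrow> \<bar>t - s\<bar> \<le> pi \<Longrightarrow> norm (g' t - g' s) \<le> C * \<bar>t - s\<bar>"
    "\<And>s t. s \<in> {0..2 * pi} \<Longrightarrow> \<bar>t - s\<bar> \<le> pi \<Longrightarrow>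
       norm (g t - g s - (t - s) *\<^sub>R g' s) \<le> C * \<bar>t - s\<bar>\<^sup>2"
proof -
  \<comment> \<open>The interval [- pi, 3 pi] contains every window of half-width \<open>pi\<close>
    centred in [0, 2 pi], so one Lipschitz constant of \<open>g'\<close> serves all
    \<open>s\<close>.\<close>
  obtain C where C: "C > 0"
    and lip: "\<And>s t. s \<in> {- pi..3 * pi} \<Longrightarrow> t \<in> {- pi..3 * pi} \<Longrightarrow> norm (g' t - g' s) \<le> C * \<bar>t - s\<bar>"
    using C1_imp_Lipschitz[OF deriv2 continuous_on_subset[OF cont2 subset_UNIV]] by metis
  have 1: "norm (g' t - g' s) \<le> C * \<bar>t - s\<bar>" if "s \<in> {0..2 * pi}" "\<bar>t - s\<bar> \<le> pi" for s t
    using that by (intro lip) (auto simp: abs_if split: if_splits)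
  have 2: "norm (g t - g s - (t - s) *\<^sub>R g' s) \<le> C * \<bar>t - s\<bar>\<^sup>2"
    if "s \<in> {0..2 * pi}" "\<bar>t - s\<bar> \<le> pi" for s t
  proof -
    \<comment> \<open>The mean value inequality is applied to \<open>g t - t *\<^sub>R g' s\<close>:
      its derivative \<open>g' x - g' s\<close> is at most \<open>C * \<bar>t - s\<bar>\<close> on
      the segment, which yields the quadratic remainder.\<close>
    have "norm ((g t - t *\<^sub>R g' s) - (g s - s *\<^sub>R g' s)) \<le> (C * \<bar>t - s\<bar>) * norm (t - s)"
    proof (rule differentiable_bound)
      show "convex (closed_segment s t)" by simp
      show "((\<lambda>t. g t - t *\<^sub>R g' s) has_derivative (\<lambda>h. h *\<^sub>R (g' x - g' s))) (at x within closed_segment s t)" for x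
      proof -
        have "((\<lambda>t. t *\<^sub>R g' s) has_vector_derivative g' s) (at x)"
          unfolding has_vector_derivative_def
          by (rule bounded_linear_imp_has_derivative[OF bounded_linear_scaleR_left])
        from has_vector_derivative_diff[OF deriv this] show ?thesis
          unfolding has_vector_derivative_def by (rule has_derivative_at_withinI)
      qed
      show "onorm (\<lambda>h. h *\<^sub>R (g' x - g' s)) \<le> C * \<bar>t - s\<bar>" if "x \<in> closed_segment s t" for x
      proof (rule onorm_le)
        fix h :: real
        have x: "\<bar>x - s\<bar> \<le> \<bar>t - s\<bar>"
          using that by (auto simp: closed_segment_eq_real_ivl split: if_splits)
        have "norm (g' x - g' s) \<le> C * \<bar>x - s\<bar>"
          using x \<open>s \<in> _\<close> \<open>\<bar>t - s\<bar> \<le> pi\<close> by (intro 1) auto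
        also have "\<dots> \<le> C * \<bar>t - s\<bar>"
          using x C by simp
        finally show "norm (h *\<^sub>R (g' x - g' s)) \<le> (C * \<bar>t - s\<bar>) * norm h"
          by (simp add: mult.commute mult_left_mono)
      qed
    qed auto
    then show ?thesis by (simp add: algebra_simps power2_eq_square)
  qed
  show thesis using that[OF C 1 2] .
qed

text \<open>Close to \<open>s\<close> the difference is nearly \<open>g' s\<close> times
  \<open>(t - s) - i r\<close>, whose real and imaginary parts cannot cancel. Farther away the curve
  does not return to \<open>g s\<close>, and a small \<open>r\<close> cannot bridge the gap. The
  bound is linear in both displacements and uniform in \<open>s\<close>.\<close>

lemma normal_separation:
  obtains c r0 where "c > 0" "r0 > 0"
    "\<And>s t r. s \<in> {0..2 * pi} \<Longrightarrow> \<bar>t - s\<bar> \<le> pi \<Longrightarrow> \<bar>r\<bar> \<le> r0 \<Longrightarrow>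
       c * (\<bar>t - s\<bar> + \<bar>r\<bar>) \<le> norm (g t - (g s + \<i> * of_real r * g' s))"
proof -
  obtain C where C: "C > 0"
    and C2: "\<And>s t. s \<in> {0..2 * pi} \<Longrightarrow> \<bar>t - s\<bar> \<le> pi \<Longrightarrow>
       norm (g t - g s - (t - s) *\<^sub>R g' s) \<le> C * \<bar>t - s\<bar>\<^sup>2"
    using taylor_bounds by metis
  have "continuous_on {0..2 * pi} (\<lambda>t. norm (g' t))"
    by (intro continuous_intros cont')
  from continuous_attains_inf[OF _ _ this] continuous_attains_sup[OF _ _ this]
  obtain t1 t2 where t1: "\<And>t. t \<in> {0..2 * pi} \<Longrightarrow> norm (g' t1) \<le> norm (g' t)"
    and t2: "\<And>t. t \<in> {0..2 * pi} \<Longrightarrow> norm (g' t) \<le> norm (g' t2)"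
    by fastforce
  define m where "m = norm (g' t1)"
  define M where "M = norm (g' t2)"
  have m: "m > 0" and M: "M > 0" using regular by (auto simp: m_def M_def)
  \<comment> \<open>For \<open>\<bar>t - s\<bar> \<le> d\<close> the quadratic remainder is at most
    \<open>m / 4 * \<bar>t - s\<bar>\<close>, half of the corresponding part of the linear lower
    bound \<open>m / 2 * (\<bar>t - s\<bar> + \<bar>r\<bar>)\<close>.\<close>
  define d where "d = min pi (m / (4 * C))"
  have d: "0 < d" "d \<le> pi" "d \<le> m / (4 * C)"
    using m C by (auto simp: d_def)
  \<comment> \<open>The compact set of parameter pairs at distance between \<open>d\<close> and
    \<open>pi\<close>; injectivity up to the period keeps the two points of the curve apart on
    it.\<close>
  define K where "K = ({0..2 * pi} \<times> {- pi..3 * pi}) \<inter> {p. d \<le> \<bar>snd p - fst p\<bar>} \<inter> {p. \<bar>snd p - fst p\<bar> \<le> pi}"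
  have "compact K"
    unfolding K_def by (intro compact_Int_closed compact_Times closed_Collect_le continuous_intros) auto
  moreover have "(0, pi) \<in> K" using d by (simp add: K_def)
  moreover have "continuous_on K (\<lambda>p. norm (g (snd p) - g (fst p)))"
    by (intro continuous_intros continuous_on_compose2[OF cont]) auto
  ultimately obtain p where p: "p \<in> K" "\<And>q. q \<in> K \<Longrightarrow> norm (g (snd p) - g (fst p)) \<le> norm (g (snd q) - g (fst q))"
    using continuous_attains_inf[of K] by blast
  define c0 where "c0 = norm (g (snd p) - g (fst p))"
  have "g (snd p) \<noteq> g (fst p)"
  proof
    assume "g (snd p) = g (fst p)"
    then have "fst p = snd p"
      using p(1) pi_gt_zero unfolding K_def by (intro eq_imp_eq) (auto simp del: pi_gt_zero)
    then show False using p(1) d by (simp add: K_def)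
  qed
  then have c0: "c0 > 0" by (simp add: c0_def)
  \<comment> \<open>A normal displacement with \<open>\<bar>r\<bar> \<le> r0\<close> moves a point
    by at most \<open>c0 / 2\<close>.\<close>
  define r0 where "r0 = c0 / (2 * M)"
  have r0: "r0 > 0" using c0 M by (simp add: r0_def)
  \<comment> \<open>The value \<open>m / 4\<close> is what the near case leaves. In the far case
    \<open>\<bar>t - s\<bar> + \<bar>r\<bar> \<le> pi + r0\<close>, so the second entry keeps the
    product at most \<open>c0 / 2\<close>.\<close>
  define c where "c = min (m / 4) (c0 / (2 * (pi + r0)))"
  have "c > 0" using c0 m r0 pi_gt_zero by (simp add: c_def add_pos_pos)
  moreover have "c \<le> m / 4" "c \<le> c0 / (2 * (pi + r0))"
    unfolding c_def by (rule min.cobounded1 min.cobounded2)+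
  ultimately have c: "c > 0" "c \<le> m / 4" "c \<le> c0 / (2 * (pi + r0))" by auto
  show thesis
  proof (rule that[OF c(1) r0])
    fix s t r :: real
    assume s: "s \<in> {0..2 * pi}" and t: "\<bar>t - s\<bar> \<le> pi" and r: "\<bar>r\<bar> \<le> r0"
    have ms: "m \<le> norm (g' s)" "norm (g' s) \<le> M" using t1 t2 s by (auto simp: m_def M_def)
    show "c * (\<bar>t - s\<bar> + \<bar>r\<bar>) \<le> norm (g t - (g s + \<i> * of_real r * g' s))"
    proof (cases "\<bar>t - s\<bar> \<le> d")
      case True
      have "\<bar>t - s\<bar> \<le> norm (Complex (t - s) (- r))" "\<bar>r\<bar> \<le> norm (Complex (t - s) (- r))"
        using abs_Re_le_cmod[of "Complex (t - s) (- r)"] abs_Im_le_cmod[of "Complex (t - s) (- r)"] by auto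
      then have "m * ((\<bar>t - s\<bar> + \<bar>r\<bar>) / 2) \<le> norm (g' s) * norm (Complex (t - s) (- r))"
        using ms m by (intro mult_mono) auto
      also have "\<dots> = norm ((t - s) *\<^sub>R g' s - \<i> * of_real r * g' s)"
        by (simp add: Complex_eq scaleR_conv_of_real algebra_simps flip: norm_mult)
      also have "\<dots> \<le> norm (g t - (g s + \<i> * of_real r * g' s)) + norm (g t - g s - (t - s) *\<^sub>R g' s)"
        by (rule order_trans[OF _ norm_triangle_ineq4]) (simp add: algebra_simps)
      also have "norm (g t - g s - (t - s) *\<^sub>R g' s) \<le> C * \<bar>t - s\<bar>\<^sup>2"
        using s t by (rule C2)
      also have "C * \<bar>t - s\<bar>\<^sup>2 \<le> C * (m / (4 * C) * \<bar>t - s\<bar>)"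
        unfolding power2_eq_square using True d C by (intro mult_left_mono mult_right_mono) auto
      also have "\<dots> = m / 4 * \<bar>t - s\<bar>" using C by simp
      finally have "m / 4 * (\<bar>t - s\<bar> + \<bar>r\<bar>) \<le> norm (g t - (g s + \<i> * of_real r * g' s)) - m / 4 * \<bar>r\<bar>"
        by (simp add: algebra_simps)
      also have "\<dots> \<le> norm (g t - (g s + \<i> * of_real r * g' s))" using m by simp
      finally have "m / 4 * (\<bar>t - s\<bar> + \<bar>r\<bar>) \<le> norm (g t - (g s + \<i> * of_real r * g' s))" .
      moreover have "c * (\<bar>t - s\<bar> + \<bar>r\<bar>) \<le> m / 4 * (\<bar>t - s\<bar> + \<bar>r\<bar>)"
        using c by (intro mult_right_mono) auto
      ultimately show ?thesis by linarith
    next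
      case False
      have "(s, t) \<in> K"
        using s t False by (auto simp: K_def abs_if split: if_splits)
      then have "c0 \<le> norm (g t - g s)" using p(2) by (fastforce simp: c0_def)
      also have "\<dots> \<le> norm (g t - (g s + \<i> * of_real r * g' s)) + norm (\<i> * of_real r * g' s)"
        by (rule order_trans[OF _ norm_triangle_ineq]) simp
      also have "norm (\<i> * of_real r * g' s) \<le> r0 * M"
        using ms r by (simp add: norm_mult mult_mono)
      also have "r0 * M = c0 / 2" using M by (simp add: r0_def)
      finally have "c0 / 2 \<le> norm (g t - (g s + \<i> * of_real r * g' s))" by simp
      moreover have "c * (\<bar>t - s\<bar> + \<bar>r\<bar>) \<le> c0 / (2 * (pi + r0)) * (pi + r0)"
        using c t r r0 c0 pi_gt_zero by (intro mult_mono) auto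
      moreover have "c0 / (2 * x) * x = c0 / 2" if "x > 0" for x
        using that by simp
      from this[of "pi + r0"] have "c0 / (2 * (pi + r0)) * (pi + r0) = c0 / 2"
        using r0 pi_gt_zero by (simp only: add_pos_pos)
      ultimately show ?thesis by linarith
    qed
  qed
qed

lemma push_notin_curve:
  obtains r0 where "r0 > 0"
    "\<And>s r. s \<in> {0..2 * pi} \<Longrightarrow> r \<noteq> 0 \<Longrightarrow> \<bar>r\<bar> \<le> r0 \<Longrightarrow> g s + \<i> * of_real r * g' s \<notin> path_image (bpath g)"
proof -
  obtain c r0 where "c > 0" "r0 > 0" and *:
    "\<And>s t r. s \<in> {0..2 * pi} \<Longrightarrow> \<bar>t - s\<bar> \<le> pi \<Longrightarrow> \<bar>r\<bar> \<le> r0 \<Longrightarrow>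
       c * (\<bar>t - s\<bar> + \<bar>r\<bar>) \<le> norm (g t - (g s + \<i> * of_real r * g' s))"
    using normal_separation by metis
  have "g s + \<i> * of_real r * g' s \<notin> path_image (bpath g)"
    if s: "s \<in> {0..2 * pi}" and r: "r \<noteq> 0" "\<bar>r\<bar> \<le> r0" for s r
  proof
    assume "g s + \<i> * of_real r * g' s \<in> path_image (bpath g)"
    then obtain t where "g s + \<i> * of_real r * g' s = g t"
      by (auto simp: path_image_bpath)
    then obtain t' where t': "\<bar>t' - s\<bar> \<le> pi" "g t' = g s + \<i> * of_real r * g' s"
      using centered_representative[of s t] by metis
    have "0 < c * (\<bar>t' - s\<bar> + \<bar>r\<bar>)" using \<open>c > 0\<close> r by (intro mult_pos_pos add_nonneg_pos) auto
    then show False using *[OF s t'(1) r(2)] t'(2) by simp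
  qed
  then show thesis using that \<open>r0 > 0\<close> by blast
qed

text \<open>Stationarity of the squared distance makes \<open>p - g t\<close> orthogonal to
  \<open>g' t\<close>, so \<open>(p - g t) / g' t\<close> is purely imaginary; its imaginary part is
  \<open>r\<close>.\<close>

lemma nearest_point_normal:
  obtains t r where "t \<in> {0..2 * pi}" "p = g t + \<i> * of_real r * g' t"
    "\<And>u. norm (p - g t) \<le> norm (p - g u)"
proof -
  have "continuous_on {0..2 * pi} (\<lambda>t. norm (p - g t))"
    by (intro continuous_intros cont)
  from continuous_attains_inf[OF _ _ this]
  obtain t where t: "t \<in> {0..2 * pi}" "\<And>u. u \<in> {0..2 * pi} \<Longrightarrow> norm (p - g t) \<le> norm (p - g u)"
    by fastforce
  \<comment> \<open>By periodicity the minimum over one period is a minimum over all real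
    parameters, so the derivative test also applies when \<open>t\<close> is an endpoint.\<close>
  have min: "norm (p - g t) \<le> norm (p - g u)" for u
  proof -
    obtain u' where "u' \<in> {0..2 * pi}" "g u = g u'"
      using in_curve[of u] by (auto simp: path_image_bpath)
    then show ?thesis using t(2) by simp
  qed
  have "((\<lambda>u. (p - g u) \<bullet> (p - g u)) has_real_derivative - 2 * ((p - g t) \<bullet> g' t)) (at t)"
    using deriv[of t] unfolding has_vector_derivative_def has_field_derivative_def
    by (auto intro!: derivative_eq_intros simp: inner_commute algebra_simps fun_eq_iff)
  from DERIV_local_min[OF this, of 1]
  have "(p - g t) \<bullet> g' t = 0"
    using min by (simp add: power2_norm_eq_inner[symmetric] power_mono)
  then have "Re ((p - g t) * cnj (g' t)) = 0"
    by (simp add: inner_complex_def)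
  then have "Re ((p - g t) / g' t) = 0"
    by (simp add: Re_complex_div_eq_0)
  then have "(p - g t) / g' t = \<i> * of_real (Im ((p - g t) / g' t))"
    by (simp add: complex_eq_iff)
  then have "p = g t + \<i> * of_real (Im ((p - g t) / g' t)) * g' t"
    using regular[of t] by (metis add_diff_cancel_left' diff_add_cancel nonzero_divide_eq_eq add.commute)
  then show thesis using that t(1) min by blast
qed

text \<open>At a nearest point \<open>\<bar>r\<bar> * norm (g' t)\<close> is the distance to the
  curve, so the minimum of \<open>norm (g' t)\<close> turns closeness into a bound on
  \<open>r\<close>. Covering by normals is obtained this way without the inverse function
  theorem.\<close>

lemma tubular_neighbourhood:
  assumes "\<rho> > 0"
  obtains \<epsilon> where "\<epsilon> > 0"
    "\<And>p u. norm (p - g u) < \<epsilon> \<Longrightarrow> \<exists>t\<in>{0..2 * pi}. \<exists>r. \<bar>r\<bar> < \<rho> \<and> p = g t + \<i> * of_real r * g' t"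
proof -
  have "continuous_on {0..2 * pi} (\<lambda>t. norm (g' t))"
    by (intro continuous_intros cont')
  from continuous_attains_inf[OF _ _ this]
  obtain t1 where t1: "\<And>t. t \<in> {0..2 * pi} \<Longrightarrow> norm (g' t1) \<le> norm (g' t)"
    by fastforce
  show thesis
  proof (rule that[of "\<rho> * norm (g' t1)"])
    show "\<rho> * norm (g' t1) > 0" using assms regular by simp
    fix p u assume pu: "norm (p - g u) < \<rho> * norm (g' t1)"
    obtain t r where t: "t \<in> {0..2 * pi}" and p: "p = g t + \<i> * of_real r * g' t"
      and min: "norm (p - g t) \<le> norm (p - g u)"
      using nearest_point_normal by metis
    have "\<bar>r\<bar> * norm (g' t) = norm (p - g t)"
      unfolding p by (simp add: norm_mult)
    also have "\<dots> < \<rho> * norm (g' t1)" using min pu by simp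
    also have "\<dots> \<le> \<rho> * norm (g' t)" using t1[OF t] assms by simp
    finally have "\<bar>r\<bar> < \<rho>" by (simp add: regular mult_less_cancel_right)
    with t p show "\<exists>t\<in>{0..2 * pi}. \<exists>r. \<bar>r\<bar> < \<rho> \<and> p = g t + \<i> * of_real r * g' t" by blast
  qed
qed

end

section \<open>The region and its holes\<close>

text \<open>\<open>bounded_compl\<close> expresses that infinity lies in \<open>G\<close>.
  Orientation is recorded by winding numbers and not by a choice of normal, so the side to which
  \<open>\<i> * \<eta>' k t\<close> points has to be found later, as a sign.\<close>

locale smooth_region =
  fixes m :: nat and \<eta> \<eta>' \<eta>'' :: "nat \<Rightarrow> real \<Rightarrow> complex" and G :: "complex set"
  assumes loop: "\<And>k. k < m \<Longrightarrow> smooth_loop (\<eta> k) (\<eta>' k) (\<eta>'' k)"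
    and disjoint: "\<And>j k. j < m \<Longrightarrow> k < m \<Longrightarrow> j \<noteq> k \<Longrightarrow>
                     path_image (bpath (\<eta> j)) \<inter> path_image (bpath (\<eta> k)) = {}"
    and open_G: "open G" and connected_G: "connected G" and nonempty_G: "G \<noteq> {}"
    and bounded_compl: "bounded (- G)"
    and frontier_G: "frontier G = (\<Union>k<m. path_image (bpath (\<eta> k)))"
    and clockwise: "\<And>k z. k < m \<Longrightarrow> z \<notin> path_image (bpath (\<eta> k)) \<Longrightarrow>
                      winding_number (bpath (\<eta> k)) z \<in> {0, -1}"
    and left: "\<And>k z. k < m \<Longrightarrow> z \<in> G \<Longrightarrow> winding_number (bpath (\<eta> k)) z = 0"
begin

abbreviation "curve k \<equiv> path_image (bpath (\<eta> k))"
abbreviation "hole k \<equiv> inside (curve k)"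
abbreviation "push k r t \<equiv> \<eta> k t + \<i> * of_real r * \<eta>' k t"

lemma
  assumes "k < m"
  shows open_hole: "open (hole k)" and connected_hole: "connected (hole k)"
    and frontier_hole: "frontier (hole k) = curve k"
  using Jordan_inside_outside[OF smooth_loop.simple_path smooth_loop.loop, OF loop loop, OF assms assms]
  by auto

lemma compact_curve: "k < m \<Longrightarrow> compact (curve k)"
  using smooth_loop.path[OF loop] by (rule compact_path_image)

text \<open>The Jordan curve theorem determines the winding number up to sign, and
  \<open>clockwise\<close> fixes the sign.\<close>

lemma winding_number_hole:
  assumes "k < m" "z \<in> hole k"
  shows "winding_number (bpath (\<eta> k)) z = - 1"
proof -
  have "norm (winding_number (bpath (\<eta> k)) z) = 1"
    using assms smooth_loop.simple_path[OF loop] by (intro simple_closed_path_norm_winding_number_inside) auto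
  moreover have "z \<notin> curve k"
    using assms(2) inside_no_overlap by blast
  ultimately show ?thesis
    using clockwise[OF assms(1), of z] by auto
qed

lemma curve_not_G: "k < m \<Longrightarrow> curve k \<inter> G = {}"
  using frontier_G frontier_disjoint_eq[of G] open_G by blast

text \<open>A point of the hole and of \<open>G\<close> would have both winding numbers
  \<open>- 1\<close> and \<open>0\<close>. The hole is open, so it misses the closure as
  well.\<close>

lemma hole_not_closure_G:
  assumes "k < m" shows "hole k \<inter> closure G = {}"
proof -
  have "hole k \<inter> G = {}"
    using winding_number_hole[OF assms] left[OF assms] by fastforce
  then show ?thesis
    using open_hole[OF assms] open_Int_closure_eq_empty by blast
qed

lemma curve_subset_closure: "k < m \<Longrightarrow> curve k \<subseteq> closure G"
  using frontier_G by (auto simp: frontier_def)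

section \<open>Collars of the boundary curves and the sides on which they lie\<close>

text \<open>A pushed point is kept off its own curve by the normal estimate and off any other curve
  by the positive distance of disjoint compact sets. Phrasing both as eventual statements at
  \<open>0\<close> gives one width for the finitely many pairs.\<close>

lemma push_notin_curves:
  "\<exists>\<rho>>0. \<forall>k<m. \<forall>t\<in>{0..2 * pi}. \<forall>r. r \<noteq> 0 \<longrightarrow> \<bar>r\<bar> \<le> \<rho> \<longrightarrow> push k r t \<notin> frontier G"
proof -
  have "\<forall>\<^sub>F \<rho> in at_right 0. \<forall>t\<in>{0..2 * pi}. \<forall>r. r \<noteq> 0 \<longrightarrow> \<bar>r\<bar> \<le> \<rho> \<longrightarrow> push k r t \<notin> curve j"
    if kj: "k < m" "j < m" for k j
  proof (cases "k = j")
    case True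
    obtain r0 where "r0 > 0"
      "\<And>s r. s \<in> {0..2 * pi} \<Longrightarrow> r \<noteq> 0 \<Longrightarrow> \<bar>r\<bar> \<le> r0 \<Longrightarrow> push k r s \<notin> curve k"
      using smooth_loop.push_notin_curve[OF loop, OF kj(1)] by metis
    then show ?thesis
      unfolding eventually_at_right_field using True by (intro exI[of _ r0]) auto
  next
    case False
    then obtain d where d: "d > 0" "\<And>x y. x \<in> curve k \<Longrightarrow> y \<in> curve j \<Longrightarrow> d \<le> dist x y"
      using separate_compact_closed[OF compact_curve compact_imp_closed, OF _ compact_curve, of k j]
        disjoint kj by metis
    have "continuous_on {0..2 * pi} (\<eta>' k)"
      using smooth_loop.cont'[OF loop, OF kj(1)] .
    then have "bounded (\<eta>' k ` {0..2 * pi})"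
      by (intro compact_imp_bounded compact_continuous_image) auto
    then obtain M where M: "M > 0" "\<And>t. t \<in> {0..2 * pi} \<Longrightarrow> norm (\<eta>' k t) \<le> M"
      unfolding bounded_pos by auto
    have "push k r t \<notin> curve j" if t: "t \<in> {0..2 * pi}" and r: "\<bar>r\<bar> < d / M" for r t
    proof
      assume "push k r t \<in> curve j"
      then have "d \<le> dist (\<eta> k t) (push k r t)"
        using d(2) smooth_loop.in_curve[OF loop, OF kj(1)] by blast
      also have "\<dots> = \<bar>r\<bar> * norm (\<eta>' k t)" by (simp add: dist_norm norm_mult)
      also have "\<dots> \<le> \<bar>r\<bar> * M" using M(2)[OF t] by (simp add: mult_left_mono)
      also have "\<dots> < d" using r M by (simp add: field_simps)
      finally show False by simp
    qed
    then show ?thesis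
      unfolding eventually_at_right_field using d M by (intro exI[of _ "d / M"]) auto
  qed
  then have "\<forall>\<^sub>F \<rho> in at_right 0. \<forall>k\<in>{..<m}. \<forall>j\<in>{..<m}.
      \<forall>t\<in>{0..2 * pi}. \<forall>r. r \<noteq> 0 \<longrightarrow> \<bar>r\<bar> \<le> \<rho> \<longrightarrow> push k r t \<notin> curve j"
    by (intro eventually_ball_finite[OF finite_lessThan] ballI) auto
  then obtain b where "b > 0" and b: "\<And>\<rho>. 0 < \<rho> \<Longrightarrow> \<rho> < b \<Longrightarrow> \<forall>k\<in>{..<m}. \<forall>j\<in>{..<m}.
      \<forall>t\<in>{0..2 * pi}. \<forall>r. r \<noteq> 0 \<longrightarrow> \<bar>r\<bar> \<le> \<rho> \<longrightarrow> push k r t \<notin> curve j"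
    unfolding eventually_at_right_field by blast
  show ?thesis
    using b[of "b / 2"] \<open>b > 0\<close> unfolding frontier_G by (intro exI[of _ "b / 2"]) auto
qed

text \<open>The sign \<open>\<sigma>\<close> picks the side while \<open>r\<close> stays strictly
  positive, so each side is the continuous image of a connected rectangle and, for small
  \<open>\<rho>\<close>, avoids the boundary.\<close>

definition collar :: "nat \<Rightarrow> real \<Rightarrow> real \<Rightarrow> complex set"
  where "collar k \<rho> \<sigma> = (\<lambda>(t, r). push k (\<sigma> * r) t) ` ({0..2 * pi} \<times> {0<..<\<rho>})"

lemma connected_collar:
  assumes "k < m" shows "connected (collar k \<rho> \<sigma>)"
proof -
  have "continuous_on ({0..2 * pi} \<times> {0<..<\<rho>}) (\<lambda>p. push k (\<sigma> * snd p) (fst p))"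
    using smooth_loop.cont[OF loop, OF assms] smooth_loop.cont'[OF loop, OF assms]
    by (intro continuous_intros continuous_on_compose2[where f = fst, OF _ continuous_on_fst]) auto
  then show ?thesis
    unfolding collar_def case_prod_unfold
    by (intro connected_continuous_image connected_Times) auto
qed

lemma near_curve_in_collars:
  assumes "k < m" "\<rho> > 0" "p \<in> curve k"
  obtains \<epsilon> where "\<epsilon> > 0" "ball p \<epsilon> \<subseteq> curve k \<union> collar k \<rho> 1 \<union> collar k \<rho> (- 1)"
proof -
  obtain u where u: "p = \<eta> k u" using assms(3) by (auto simp: path_image_bpath)
  obtain \<epsilon> where "\<epsilon> > 0" and \<epsilon>:
    "\<And>p u. norm (p - \<eta> k u) < \<epsilon> \<Longrightarrow> \<exists>t\<in>{0..2 * pi}. \<exists>r. \<bar>r\<bar> < \<rho> \<and> p = push k r t"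
    using smooth_loop.tubular_neighbourhood[OF loop, OF assms(1,2)] by metis
  have "q \<in> curve k \<union> collar k \<rho> 1 \<union> collar k \<rho> (- 1)" if "q \<in> ball p \<epsilon>" for q
  proof -
    have "norm (q - \<eta> k u) < \<epsilon>"
      using that by (simp add: u dist_norm norm_minus_commute)
    then obtain t r where t: "t \<in> {0..2 * pi}" and r: "\<bar>r\<bar> < \<rho>" and q: "q = push k r t"
      using \<epsilon> by blast
    consider "r = 0" | "r > 0" | "r < 0" by linarith
    then show ?thesis
    proof cases
      case 1
      then show ?thesis using q smooth_loop.in_curve[OF loop, OF assms(1)] by simp
    next
      case 2
      then have "q \<in> collar k \<rho> 1"
        unfolding collar_def using t r q by (intro image_eqI[of _ _ "(t, r)"]) auto
      then show ?thesis by blast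
    next
      case 3
      then have "q \<in> collar k \<rho> (- 1)"
        unfolding collar_def using t r q by (intro image_eqI[of _ _ "(t, - r)"]) auto
      then show ?thesis by blast
    qed
  qed
  then show thesis using that \<open>\<epsilon> > 0\<close> by blast
qed

text \<open>A connected set that misses the frontier of another set lies inside it as soon as it
  meets it. The point \<open>\<eta> k 0\<close> is a limit of points of \<open>G\<close> and of
  points of the hole; near it both must lie in collars, and in different ones because
  \<open>G\<close> and the hole are disjoint.\<close>

lemma one_sided_collars:
  obtains \<rho> \<sigma> where "\<rho> > 0" "\<And>k. k < m \<Longrightarrow> \<sigma> k \<in> {1, - 1 :: real}"
    "\<And>k. k < m \<Longrightarrow> collar k \<rho> (\<sigma> k) \<subseteq> G" "\<And>k. k < m \<Longrightarrow> collar k \<rho> (- \<sigma> k) \<subseteq> hole k"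
proof -
  obtain \<rho> where \<rho>: "\<rho> > 0" "\<And>k t r. k < m \<Longrightarrow> t \<in> {0..2 * pi} \<Longrightarrow> r \<noteq> 0 \<Longrightarrow> \<bar>r\<bar> \<le> \<rho> \<Longrightarrow> push k r t \<notin> frontier G"
    using push_notin_curves by blast
  have "\<exists>\<sigma>. \<sigma> \<in> {1, - 1} \<and> collar k \<rho> \<sigma> \<subseteq> G \<and> collar k \<rho> (- \<sigma>) \<subseteq> hole k" if k: "k < m" for k
  proof -
    have off: "collar k \<rho> \<sigma> \<inter> frontier G = {}" if "\<sigma> \<in> {1, - 1}" for \<sigma>
    proof -
      have "push k (\<sigma> * r) t \<notin> frontier G" if "t \<in> {0..2 * pi}" "r \<in> {0<..<\<rho>}" for t r
        using \<open>\<sigma> \<in> _\<close> that by (intro \<rho>(2) k) auto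
      then show ?thesis unfolding collar_def by auto
    qed
    have G: "collar k \<rho> \<sigma> \<subseteq> G" if "\<sigma> \<in> {1, - 1}" "collar k \<rho> \<sigma> \<inter> G \<noteq> {}" for \<sigma>
      using connected_Int_frontier[OF connected_collar[OF k] that(2)] off[OF that(1)] by blast
    have hole: "collar k \<rho> \<sigma> \<subseteq> hole k" if "\<sigma> \<in> {1, - 1}" "collar k \<rho> \<sigma> \<inter> hole k \<noteq> {}" for \<sigma>
      using connected_Int_frontier[OF connected_collar[OF k] that(2)] off[OF that(1)] k
      unfolding frontier_hole[OF k] frontier_G by blast
    have p: "\<eta> k 0 \<in> curve k" using smooth_loop.in_curve[OF loop, OF k] .
    obtain \<epsilon> where "\<epsilon> > 0" and \<epsilon>: "ball (\<eta> k 0) \<epsilon> \<subseteq> curve k \<union> collar k \<rho> 1 \<union> collar k \<rho> (- 1)"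
      using near_curve_in_collars[OF k \<rho>(1) p] .
    have "\<eta> k 0 \<in> closure G" "\<eta> k 0 \<in> closure (hole k)"
      using p curve_subset_closure[OF k] frontier_hole[OF k] by (auto simp: frontier_def)
    then obtain x y where x: "x \<in> G" "x \<in> ball (\<eta> k 0) \<epsilon>" and y: "y \<in> hole k" "y \<in> ball (\<eta> k 0) \<epsilon>"
      using \<open>\<epsilon> > 0\<close> unfolding closure_approachable by (metis dist_commute mem_ball)
    have "x \<notin> curve k" "y \<notin> curve k"
      using x y curve_not_G[OF k] inside_no_overlap[of "curve k"] by blast+
    then obtain \<sigma> \<tau> where \<sigma>: "\<sigma> \<in> {1, - 1}" "x \<in> collar k \<rho> \<sigma>" and \<tau>: "\<tau> \<in> {1, - 1}" "y \<in> collar k \<rho> \<tau>"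
      using x y \<epsilon> by blast
    have "collar k \<rho> \<sigma> \<subseteq> G" "collar k \<rho> \<tau> \<subseteq> hole k"
      using G[OF \<sigma>(1)] hole[OF \<tau>(1)] \<sigma>(2) \<tau>(2) x(1) y(1) by blast+
    moreover have "hole k \<inter> G = {}"
      using hole_not_closure_G[OF k] closure_subset by blast
    ultimately have "\<sigma> \<noteq> \<tau>" using \<sigma>(2) by blast
    then have "\<tau> = - \<sigma>" using \<sigma>(1) \<tau>(1) by auto
    then show ?thesis using \<sigma>(1) \<open>collar k \<rho> \<sigma> \<subseteq> G\<close> \<open>collar k \<rho> \<tau> \<subseteq> hole k\<close> by blast
  qed
  then obtain \<sigma> where "\<And>k. k < m \<Longrightarrow> \<sigma> k \<in> {1, - 1} \<and> collar k \<rho> (\<sigma> k) \<subseteq> G \<and> collar k \<rho> (- \<sigma> k) \<subseteq> hole k"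
    by metis
  then show thesis using that \<rho>(1) by blast
qed

text \<open>The points outside the closure of \<open>G\<close> and all holes form a clopen set, since near each
  boundary curve the two collars already belong to \<open>G\<close> and to a hole.\<close>
lemma outside_in_hole:
  assumes "p \<notin> closure G"
  shows "\<exists>k<m. p \<in> hole k"
proof -
  define U where "U = - (closure G \<union> (\<Union>k<m. hole k))"
  obtain \<rho> \<sigma> where \<rho>: "\<rho> > 0" and \<sigma>: "\<And>k. k < m \<Longrightarrow> \<sigma> k \<in> {1, - 1 :: real}"
    and in_G: "\<And>k. k < m \<Longrightarrow> collar k \<rho> (\<sigma> k) \<subseteq> G"
    and in_hole: "\<And>k. k < m \<Longrightarrow> collar k \<rho> (- \<sigma> k) \<subseteq> hole k"
    using one_sided_collars by metis
  have closure_eq: "closure G = G \<union> (\<Union>k<m. curve k)"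
    using frontier_G closure_Un_frontier[of G] by simp
  have "closed (closure G \<union> (\<Union>k<m. hole k))"
  proof -
    have "closure (hole k) = hole k \<union> curve k" if "k < m" for k
      using frontier_hole[OF that] closure_Un_frontier[of "hole k"] by simp
    then have "closure G \<union> (\<Union>k<m. hole k) = closure G \<union> (\<Union>k<m. closure (hole k))"
      unfolding closure_eq by auto
    then show ?thesis by (simp add: closed_Un closed_UN)
  qed
  then have "open U" unfolding U_def by (rule open_Compl)
  moreover have "open (- U)"
  proof (subst open_contains_ball, intro ballI)
    fix q assume "q \<in> - U"
    then consider "q \<in> G" | k where "k < m" "q \<in> curve k" | k where "k < m" "q \<in> hole k"
      by (auto simp: U_def closure_eq)
    then show "\<exists>e>0. ball q e \<subseteq> - U"
    proof cases
      case 1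
      then obtain e where "e > 0" "ball q e \<subseteq> G" using open_G open_contains_ball by blast
      then show ?thesis by (intro exI[of _ e]) (auto simp: U_def closure_eq)
    next
      case 2
      then obtain \<epsilon> where "\<epsilon> > 0" and \<epsilon>: "ball q \<epsilon> \<subseteq> curve k \<union> collar k \<rho> 1 \<union> collar k \<rho> (- 1)"
        using near_curve_in_collars[OF _ \<rho>] by metis
      have "collar k \<rho> 1 \<union> collar k \<rho> (- 1) = collar k \<rho> (\<sigma> k) \<union> collar k \<rho> (- \<sigma> k)"
        using \<sigma>[OF 2(1)] by auto
      also have "\<dots> \<subseteq> - U"
        using in_G[OF 2(1)] in_hole[OF 2(1)] 2(1) by (auto simp: U_def closure_eq)
      finally have "ball q \<epsilon> \<subseteq> - U"
        using \<epsilon> 2(1) by (auto simp: U_def closure_eq)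
      then show ?thesis using \<open>\<epsilon> > 0\<close> by blast
    next
      case 3
      then obtain e where "e > 0" "ball q e \<subseteq> hole k" using open_hole open_contains_ball by blast
      then show ?thesis using 3(1) by (intro exI[of _ e]) (auto simp: U_def)
    qed
  qed
  ultimately have "U = {} \<or> U = UNIV"
    using clopen[of U] closed_def by blast
  moreover have "U \<noteq> UNIV"
    using nonempty_G closure_subset by (auto simp: U_def)
  ultimately show ?thesis using assms by (auto simp: U_def)
qed

section \<open>Winding numbers of the boundary curves about the holes\<close>

text \<open>\<open>G\<close> and \<open>hole k\<close> both touch a point \<open>q\<close> of curve
  \<open>k\<close>, which curve \<open>j\<close> avoids. The winding number of curve
  \<open>j\<close> is therefore constant from \<open>hole k\<close> through \<open>q\<close> into
  \<open>G\<close>, where it is \<open>0\<close>.\<close>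

lemma winding_number_other_hole:
  assumes "j < m" "k < m" "j \<noteq> k" "p \<in> hole k"
  shows "winding_number (bpath (\<eta> j)) p = 0"
proof -
  define q where "q = \<eta> k 0"
  have q: "q \<in> curve k" unfolding q_def using smooth_loop.in_curve[OF loop, OF assms(2)] .
  have path_j: "path (bpath (\<eta> j))" "pathfinish (bpath (\<eta> j)) = pathstart (bpath (\<eta> j))"
    using smooth_loop.path[OF loop] smooth_loop.loop[OF loop] assms(1) by auto
  have con: "connected (insert q T)" if "connected T" "q \<in> closure T" for T
    using that closure_subset[of T] by (intro connected_intermediate_closure[OF that(1)]) auto
  have "q \<notin> curve j" using q disjoint[OF assms(1-3)] by blast
  obtain z where z: "z \<in> G" using nonempty_G by blast
  have "winding_number (bpath (\<eta> j)) constant_on insert q G"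
    using con[OF connected_G] q curve_subset_closure[OF assms(2)] curve_not_G[OF assms(1)] \<open>q \<notin> curve j\<close>
    by (intro winding_number_constant path_j) blast+
  then have "winding_number (bpath (\<eta> j)) q = winding_number (bpath (\<eta> j)) z"
    using z unfolding constant_on_def by (metis insertCI)
  moreover have "winding_number (bpath (\<eta> j)) constant_on insert q (hole k)"
  proof (intro winding_number_constant path_j con connected_hole assms(2))
    show "q \<in> closure (hole k)" using q frontier_hole[OF assms(2)] by (auto simp: frontier_def)
    show "insert q (hole k) \<inter> curve j = {}"
      using \<open>q \<notin> curve j\<close> hole_not_closure_G[OF assms(2)] curve_subset_closure[OF assms(1)] by blast
  qed
  then have "winding_number (bpath (\<eta> j)) p = winding_number (bpath (\<eta> j)) q"
    using assms(4) unfolding constant_on_def by (metis insertCI)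
  ultimately show ?thesis using left[OF assms(1) z] by simp
qed

lemma winding_number_sum_hole:
  assumes "k < m" "p \<in> hole k"
  shows "(\<Sum>j<m. winding_number (bpath (\<eta> j)) p) = - 1"
proof -
  have "(\<Sum>j<m. winding_number (bpath (\<eta> j)) p) = (\<Sum>j<m. if j = k then - 1 else 0)"
    using winding_number_hole[OF assms] winding_number_other_hole[OF _ assms(1) _ assms(2)]
    by (intro sum.cong) auto
  then show ?thesis using assms(1) by simp
qed

end

section \<open>Cauchy's integral formula up to the boundary\<close>

context smooth_region begin

lemma push_in_collar:
  assumes "t \<in> {0..2 * pi}" "0 < r" "r < \<rho>"
  shows "push k (\<sigma> * r) t \<in> collar k \<rho> \<sigma>"
  unfolding collar_def using assms by (intro image_eqI[of _ _ "(t, r)"]) auto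

text \<open>\<open>\<Phi> d\<close> is the total integral with all boundary curves pushed by
  \<open>d\<close>. It vanishes for small \<open>d > 0\<close>, where the cycle lies in
  \<open>G\<close>, and joint continuity of the integrand in \<open>(d, t)\<close> carries this
  value to \<open>d = 0\<close>. The outer circle, with winding number \<open>1\<close>, compensates
  the total \<open>- 1\<close> in each hole.\<close>

lemma Cauchy_theorem_boundary:
  assumes contF: "continuous_on (closure G) F" and holF: "F holomorphic_on G"
    and R: "R > 0" "- G \<subseteq> ball 0 R"
  shows "(\<Sum>k<m. integral {0..2 * pi} (\<lambda>t. F (\<eta> k t) * \<eta>' k t)) + contour_integral (circlepath 0 R) F = 0"
proof -
  obtain \<rho> \<sigma> where \<rho>: "\<rho> > 0"
    and in_G: "\<And>k. k < m \<Longrightarrow> collar k \<rho> (\<sigma> k) \<subseteq> G"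
    using one_sided_collars by metis
  define P where "P k d t = push k (\<sigma> k * d) t" for k d t
  define P' where "P' k d t = \<eta>' k t + \<i> * of_real (\<sigma> k * d) * \<eta>'' k t" for k d t
  have P_in_G: "P k d t \<in> G" if "k < m" "0 < d" "d < \<rho>" "t \<in> {0..2 * pi}" for k d t
    using in_G[OF that(1)] push_in_collar[OF that(4,2,3)] unfolding P_def by blast
  have P_in_closure: "P k d t \<in> closure G" if "k < m" "0 \<le> d" "d < \<rho>" "t \<in> {0..2 * pi}" for k d t
  proof (cases "d = 0")
    case True
    then show ?thesis
      using curve_subset_closure[OF that(1)] smooth_loop.in_curve[OF loop, OF that(1)] by (auto simp: P_def)
  next
    case False
    then show ?thesis using P_in_G[of k d t] that closure_subset by force
  qed
  have der: "(P k d has_vector_derivative P' k d t) (at t)" if "k < m" for k d t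
    unfolding P_def P'_def
    by (intro has_vector_derivative_add has_vector_derivative_mult_right
        smooth_loop.deriv[OF loop] smooth_loop.deriv2[OF loop] that)
  have contP: "continuous_on A (\<lambda>p. P k (fst p) (snd p))" "continuous_on A (\<lambda>p. P' k (fst p) (snd p))"
    if "k < m" for k and A :: "(real \<times> real) set"
    unfolding P_def P'_def
    using smooth_loop.cont[OF loop, OF that, of UNIV] smooth_loop.cont'[OF loop, OF that, of UNIV]
      smooth_loop.cont2[OF loop, OF that]
    by (auto intro!: continuous_intros elim!: continuous_on_compose2)
  \<comment> \<open>Stopping at \<open>\<rho>/2\<close> makes the range of \<open>d\<close> compact
    while staying inside the collars.\<close>
  have contFP: "continuous_on ({0..\<rho>/2} \<times> {0..2 * pi}) (\<lambda>p. F (P k (fst p) (snd p)) * P' k (fst p) (snd p))"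
    if "k < m" for k
    using \<rho> that
    by (intro continuous_on_mult contP continuous_on_compose2[OF contF contP(1)]) (auto intro!: P_in_closure)
  have contI: "continuous_on {0..\<rho>/2} (\<lambda>d. integral {0..2 * pi} (\<lambda>t. F (P k d t) * P' k d t))"
    if "k < m" for k
    using integral_continuous_on_param[of "{0..\<rho>/2}" 0 "2 * pi" "\<lambda>d t. F (P k d t) * P' k d t"] contFP[OF that]
    by (simp add: case_prod_unfold)
  define \<Phi> where "\<Phi> d = (\<Sum>k<m. integral {0..2 * pi} (\<lambda>t. F (P k d t) * P' k d t)) + contour_integral (circlepath 0 R) F" for d
  have "\<Phi> d = 0" if d: "d \<in> {0<..<\<rho>/2}" for d
  proof -
    have d': "0 < d" "d < \<rho>" "d \<in> {0..\<rho>/2}" using d \<rho> by auto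
    have cont_Pair: "continuous_on A (\<lambda>t. (d, t))" for A :: "real set"
      by (intro continuous_intros)
    \<comment> \<open>Index \<open>m\<close> stands for the outer circle, so the cycle is summed
      over \<open>k \<le> m\<close>.\<close>
    define q where "q k = (if k < m then bpath (P k d) else circlepath 0 R)" for k
    have q: "valid_path (bpath (P k d))" "pathfinish (bpath (P k d)) = pathstart (bpath (P k d))"
        "path_image (bpath (P k d)) \<subseteq> G" if k: "k < m" for k
    proof -
      have "continuous_on UNIV (P' k d)"
        using continuous_on_compose2[OF contP(2)[OF k] cont_Pair subset_UNIV] by simp
      then show "valid_path (bpath (P k d))"
        by (intro valid_path_bpath[OF der]) (auto simp: k)
      show "pathfinish (bpath (P k d)) = pathstart (bpath (P k d))"
        using smooth_loop.periodic[OF loop, OF k, of 0] smooth_loop.periodic'[OF loop, OF k, of 0]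
        by (simp add: bpath_def pathfinish_def pathstart_def P_def)
      show "path_image (bpath (P k d)) \<subseteq> G"
        unfolding path_image_bpath using P_in_G k d' by auto
    qed
    have sphere: "sphere 0 R \<subseteq> G" using R by force
    have q_all: "valid_path (q k) \<and> pathfinish (q k) = pathstart (q k) \<and> path_image (q k) \<subseteq> G"
      if "k \<in> {..m}" for k
      using q[of k] sphere R(1) by (simp add: q_def)
    have wn_hole: "(\<Sum>k\<le>m. winding_number (q k) w) = 0" if w: "w \<in> (\<Union>k<m. hole k)" for w
    proof -
      obtain j where j: "j < m" "w \<in> hole j" using w by blast
      then have w': "w \<notin> closure G" using hole_not_closure_G by blast
      \<comment> \<open>The straight homotopy to the boundary curve runs through curves pushed by
        smaller amounts, hence through the closure of \<open>G\<close>, which misses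
        \<open>w\<close>.\<close>
      have "winding_number (bpath (P k d)) w = winding_number (bpath (\<eta> k)) w" if k: "k < m" for k
      proof (rule winding_number_homotopic_loops, rule homotopic_loops_linear)
        fix x :: real assume x: "x \<in> {0..1}"
        have t: "2 * pi * x \<in> {0..2 * pi}" using x by simp
        have "v \<noteq> w" if "v \<in> closed_segment (P k d (2 * pi * x)) (P k 0 (2 * pi * x))" for v
        proof -
          obtain u where u: "0 \<le> u" "u \<le> 1" "v = (1 - u) *\<^sub>R P k d (2 * pi * x) + u *\<^sub>R P k 0 (2 * pi * x)"
            using \<open>v \<in> _\<close> by (auto simp: in_segment)
          have "v = P k ((1 - u) * d) (2 * pi * x)"
            unfolding u P_def by (simp add: scaleR_conv_of_real algebra_simps)
          moreover have "0 \<le> (1 - u) * d" using u(2) d'(1) by simp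
          moreover have "(1 - u) * d \<le> 1 * d" using u(1) d'(1) by (intro mult_right_mono) auto
          then have "(1 - u) * d < \<rho>" using d'(2) by simp
          ultimately show ?thesis using P_in_closure k t w' by blast
        qed
        then show "closed_segment (bpath (P k d) x) (bpath (\<eta> k) x) \<subseteq> - {w}"
          by (auto simp: bpath_def P_def)
      qed (use q[OF k] smooth_loop.path[OF loop, OF k] smooth_loop.loop[OF loop, OF k] in
          \<open>auto intro: valid_path_imp_path\<close>)
      then have "(\<Sum>k<m. winding_number (q k) w) = (\<Sum>k<m. winding_number (bpath (\<eta> k)) w)"
        by (intro sum.cong) (auto simp: q_def)
      also have "\<dots> = - 1" using winding_number_sum_hole j by blast
      finally have "(\<Sum>k<m. winding_number (q k) w) = - 1" .
      moreover have "w \<in> ball 0 R" using R w' closure_subset by blast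
      then have "winding_number (q m) w = 1"
        unfolding q_def by (simp add: winding_number_circlepath)
      ultimately show ?thesis by (simp add: lessThan_Suc_atMost[symmetric])
    qed
    \<comment> \<open>For \<open>w\<close> on a boundary curve the homotopy passes through
      \<open>w\<close>. The sum is however continuous off the loops, which lie in \<open>G\<close>,
      and the complement of \<open>G\<close> is contained in the closure of the holes, so the value
      \<open>0\<close> extends.\<close>
    have "(\<Sum>k\<le>m. winding_number (q k) w) = 0" if w: "w \<notin> G" for w
    proof (rule continuous_constant_on_closure[of "\<Union>k<m. hole k" "\<lambda>w. \<Sum>k\<le>m. winding_number (q k) w"])
      have "(\<Union>k<m. hole k) \<subseteq> - G" using hole_not_closure_G closure_subset[of G] by blast
      then have "closure (\<Union>k<m. hole k) \<subseteq> - G"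
        using open_G by (intro closure_minimal) (auto simp: closed_Compl)
      then show "continuous_on (closure (\<Union>k<m. hole k)) (\<lambda>w. \<Sum>k\<le>m. winding_number (q k) w)"
        using q_all
        by (intro continuous_on_sum continuous_on_subset[OF continuous_on_winding_number] valid_path_imp_path) blast+
      show "w \<in> closure (\<Union>k<m. hole k)"
      proof (cases "w \<in> closure G")
        case True
        then have "w \<in> frontier G" using w open_G by (simp add: frontier_def interior_open)
        then obtain k where "k < m" "w \<in> frontier (hole k)"
          unfolding frontier_G using frontier_hole by blast
        then show ?thesis
          unfolding frontier_def using closure_mono[of "hole k" "\<Union>k<m. hole k"] by blast
      next
        case False
        then have "w \<in> (\<Union>k<m. hole k)" using outside_in_hole by blast
        then show ?thesis by (rule subsetD[OF closure_subset])
      qed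
    qed (rule wn_hole)
    then have "(\<Sum>k\<le>m. contour_integral (q k) F) = 0"
      using q_all by (intro Cauchy_theorem_loops[OF open_G connected_G _ _ _ holF]) auto
    moreover have "contour_integral (bpath (P k d)) F = integral {0..2 * pi} (\<lambda>t. F (P k d t) * P' k d t)"
      if k: "k < m" for k
    proof (rule contour_integral_bpath[OF der[OF k]], rule integrable_continuous_real)
      show "continuous_on {0..2 * pi} (\<lambda>t. F (P k d t) * P' k d t)"
        using continuous_on_compose2[OF contFP[OF k] cont_Pair, of "{0..2 * pi}"] d'(3) by fastforce
    qed
    ultimately show ?thesis
      by (simp add: lessThan_Suc_atMost[symmetric] \<Phi>_def q_def)
  qed
  moreover have "closure {0<..<\<rho>/2} = {0..\<rho>/2}" using \<rho> by simp
  moreover have "continuous_on {0..\<rho>/2} \<Phi>"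
    unfolding \<Phi>_def by (intro continuous_intros contI) auto
  ultimately have "\<Phi> 0 = 0"
    using continuous_constant_on_closure[of "{0<..<\<rho>/2}" \<Phi> 0 0] \<rho> by auto
  then show ?thesis by (simp add: \<Phi>_def P_def P'_def)
qed

text \<open>The kernel decays like \<open>1 / R\<close> against the length
  \<open>2 * pi * R\<close>, so no rate of decay of \<open>f\<close> enters. With distance at least
  \<open>R / 2\<close> from \<open>z\<close>, the threshold \<open>e / (8 * pi)\<close> yields
  \<open>e / 2\<close>.\<close>

lemma circle_integral_tendsto_0:
  assumes f: "(f \<longlongrightarrow> 0) at_infinity" and cont: "continuous_on G f"
  shows "((\<lambda>R. contour_integral (circlepath 0 R) (\<lambda>w. f w / (w - z))) \<longlongrightarrow> 0) at_top"
proof (rule tendstoI)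
  fix e :: real assume "e > 0"
  obtain R1 where R1: "- G \<subseteq> ball 0 R1" using bounded_compl bounded_subset_ballD by blast
  have "\<forall>\<^sub>F w in at_infinity. norm (f w) < e / (8 * pi)"
    using f \<open>e > 0\<close> by (auto simp: tendsto_iff)
  then obtain R2 where R2: "\<And>w. R2 \<le> norm w \<Longrightarrow> norm (f w) < e / (8 * pi)"
    unfolding eventually_at_infinity by blast
  have "norm (contour_integral (circlepath 0 R) (\<lambda>w. f w / (w - z))) < e"
    if R: "R > 0" "R \<ge> R1" "R \<ge> R2" "R > 2 * norm z" for R
  proof -
    have far: "R / 2 \<le> norm (w - z)" if "norm w = R" for w
      using norm_triangle_ineq2[of w z] R(4) that by linarith
    have "continuous_on (path_image (circlepath 0 R)) (\<lambda>w. f w / (w - z))"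
    proof (intro continuous_on_divide continuous_intros continuous_on_subset[OF cont] ballI)
      show "path_image (circlepath 0 R) \<subseteq> G" using R R1 by force
      show "w - z \<noteq> 0" if "w \<in> path_image (circlepath 0 R)" for w
        using far[of w] R(1) that by auto
    qed
    then have "(\<lambda>w. f w / (w - z)) contour_integrable_on (circlepath 0 R)"
      by (rule contour_integrable_continuous_circlepath)
    then have "norm (contour_integral (circlepath 0 R) (\<lambda>w. f w / (w - z))) \<le> (e / (8 * pi) / (R / 2)) * (2 * pi * R)"
    proof (intro has_contour_integral_bound_circlepath[OF has_contour_integral_integral])
      fix w :: complex assume "norm (w - 0) = R"
      then show "norm (f w / (w - z)) \<le> e / (8 * pi) / (R / 2)"
        unfolding norm_divide using R2[of w] R far[of w] \<open>e > 0\<close> by (intro frac_le) auto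
    qed (use R \<open>e > 0\<close> in auto)
    also have "\<dots> = e / 2" using R(1) by (simp add: field_simps)
    finally show ?thesis using \<open>e > 0\<close> by simp
  qed
  then show "\<forall>\<^sub>F R in at_top. dist (contour_integral (circlepath 0 R) (\<lambda>w. f w / (w - z))) 0 < e"
    by (intro eventually_mono[OF eventually_gt_at_top[of "max (max 0 R1) (max R2 (2 * norm z))"]]) auto
qed

text \<open>The boundary is completed by a circle whose contribution vanishes as \<open>R\<close>
  grows. Off the closure of \<open>G\<close> the integrand is holomorphic in \<open>G\<close>; for
  \<open>z \<in> G\<close> the value \<open>f z\<close> is subtracted first to remove the pole. The
  boundary curves do not wind around such \<open>z\<close>, so the subtracted term is returned by
  the circle alone.\<close>

lemma Cauchy_formula_boundary:
  assumes contf: "continuous_on (closure G) f" and holf: "f holomorphic_on G"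
    and inf: "(f \<longlongrightarrow> 0) at_infinity" and z: "z \<notin> frontier G"
  shows "(\<Sum>k<m. integral {0..2 * pi} (\<lambda>t. f (\<eta> k t) * (\<eta>' k t / (\<eta> k t - z))))
           = (if z \<in> G then 2 * of_real pi * \<i> * f z else 0)" (is "?S = _")
proof -
  define C where "C R = contour_integral (circlepath 0 R) (\<lambda>w. f w / (w - z))" for R
  have C_lim: "(C \<longlongrightarrow> 0) at_top"
    unfolding C_def by (rule circle_integral_tendsto_0[OF inf continuous_on_subset[OF contf closure_subset]])
  obtain R1 where R1: "- G \<subseteq> ball 0 R1" using bounded_compl bounded_subset_ballD by blast
  define R0 where "R0 = max (max 0 R1) (norm z)"
  have R: "R > 0" "- G \<subseteq> ball 0 R" "norm z < R" if "R > R0" for R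
    using that R1 by (auto simp: R0_def)
  have key: "?S + C R = (if z \<in> G then 2 * of_real pi * \<i> * f z else 0)" if "R > R0" for R
  proof (cases "z \<in> G")
    case False
    then have z': "z \<notin> closure G" using z open_G by (simp add: frontier_def interior_open)
    have "(\<Sum>k<m. integral {0..2 * pi} (\<lambda>t. f (\<eta> k t) / (\<eta> k t - z) * \<eta>' k t)) + C R = 0"
      unfolding C_def
    proof (rule Cauchy_theorem_boundary[OF _ _ R(1,2)[OF that]])
      show "continuous_on (closure G) (\<lambda>w. f w / (w - z))"
        using z' by (intro continuous_intros contf) auto
      show "(\<lambda>w. f w / (w - z)) holomorphic_on G"
        using False by (intro holomorphic_intros holf) auto
    qed
    then show ?thesis using False by simp
  next
    case True
    define F where "F w = (if w = z then deriv f z else (f w - f z) / (w - z))" for w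
    have holF: "F holomorphic_on G"
      unfolding F_def by (rule pole_lemma_open[OF holf open_G])
    \<comment> \<open>Continuity is glued from two relatively open pieces: \<open>G\<close>, where
      \<open>F\<close> is holomorphic, and the complement of \<open>z\<close>, where the quotient
      formula holds.\<close>
    have contF: "continuous_on (closure G) F"
    proof -
      have "continuous_on (closure G - {z}) (\<lambda>w. (f w - f z) / (w - z))"
        by (intro continuous_intros continuous_on_subset[OF contf]) auto
      then have "continuous_on (closure G - {z}) F"
        by (rule continuous_on_eq) (auto simp: F_def)
      moreover have "openin (top_of_set (closure G)) G"
        using open_G closure_subset[of G] by (simp add: open_subset)
      moreover have "openin (top_of_set (closure G)) (closure G - {z})"
        by (metis closed_singleton open_Compl Diff_eq openin_open_Int)
      moreover have "closure G = G \<union> (closure G - {z})"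
        using True closure_subset by blast
      ultimately show ?thesis
        using continuous_on_Un_local_open[of G "closure G - {z}" F] holomorphic_on_imp_continuous_on[OF holF]
        by simp
    qed
    have cS: "integral {0..2 * pi} (\<lambda>t. F (\<eta> k t) * \<eta>' k t) =
        integral {0..2 * pi} (\<lambda>t. f (\<eta> k t) * (\<eta>' k t / (\<eta> k t - z)))" if k: "k < m" for k
    proof -
      have nz: "\<eta> k t \<noteq> z" for t
        using smooth_loop.in_curve[OF loop, OF k, of t] curve_not_G[OF k] True by blast
      have cl: "\<eta> k t \<in> closure G" for t
        using smooth_loop.in_curve[OF loop, OF k, of t] curve_subset_closure[OF k] by blast
      have int1: "(\<lambda>t. f (\<eta> k t) * (\<eta>' k t / (\<eta> k t - z))) integrable_on {0..2 * pi}"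
        by (intro integrable_continuous_real continuous_intros continuous_on_compose2[OF contf]
            smooth_loop.cont[OF loop, OF k] smooth_loop.cont'[OF loop, OF k]) (auto simp: nz cl)
      have int2: "(\<lambda>t. 1 / (\<eta> k t - z) * \<eta>' k t) integrable_on {0..2 * pi}"
        by (intro integrable_continuous_real continuous_intros 
            smooth_loop.cont[OF loop, OF k] smooth_loop.cont'[OF loop, OF k]) (auto simp: nz)
      have "winding_number (bpath (\<eta> k)) z = 1 / (2 * pi * \<i>) * contour_integral (bpath (\<eta> k)) (\<lambda>w. 1 / (w - z))"
        using smooth_loop.valid_path[OF loop, OF k] True curve_not_G[OF k]
        by (intro winding_number_valid_path) auto
      then have "contour_integral (bpath (\<eta> k)) (\<lambda>w. 1 / (w - z)) = 0"
        using left[OF k True] by simp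
      then have zero: "integral {0..2 * pi} (\<lambda>t. 1 / (\<eta> k t - z) * \<eta>' k t) = 0"
        using contour_integral_bpath[OF smooth_loop.deriv[OF loop, OF k], of "\<lambda>w. 1 / (w - z)"] int2 by simp
      have "integral {0..2 * pi} (\<lambda>t. F (\<eta> k t) * \<eta>' k t) =
          integral {0..2 * pi} (\<lambda>t. f (\<eta> k t) * (\<eta>' k t / (\<eta> k t - z)) - f z * (1 / (\<eta> k t - z) * \<eta>' k t))"
        by (intro integral_cong) (simp add: F_def nz diff_divide_distrib algebra_simps)
      also have "\<dots> = integral {0..2 * pi} (\<lambda>t. f (\<eta> k t) * (\<eta>' k t / (\<eta> k t - z)))
           - f z * integral {0..2 * pi} (\<lambda>t. 1 / (\<eta> k t - z) * \<eta>' k t)"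
        by (simp only: Henstock_Kurzweil_Integration.integral_diff[OF int1 integrable_on_mult_right[OF int2]]
            Henstock_Kurzweil_Integration.integral_mult_right)
      finally show ?thesis by (simp only: zero mult_zero_right diff_zero)
    qed
    have far: "w \<noteq> z" if "w \<in> sphere 0 R" for w using R(3)[OF \<open>R > R0\<close>] that by auto
    have sph: "sphere 0 R \<subseteq> G" using R(2)[OF that] by force
    have ci: "(\<lambda>w. f w / (w - z)) contour_integrable_on circlepath 0 R"
        "(\<lambda>w. 1 / (w - z)) contour_integrable_on circlepath 0 R"
      using far R(1)[OF that] sph closure_subset[of G]
      by (intro contour_integrable_continuous_circlepath continuous_intros continuous_on_subset[OF contf]; force)+
    have "winding_number (circlepath 0 R) z = 1 / (2 * pi * \<i>) * contour_integral (circlepath 0 R) (\<lambda>w. 1 / (w - z))"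
      using far[of z] R(1)[OF that] by (intro winding_number_valid_path) auto
    then have one: "contour_integral (circlepath 0 R) (\<lambda>w. 1 / (w - z)) = 2 * of_real pi * \<i>"
      using winding_number_circlepath[of z 0 R] R(3)[OF that] by simp
    have "contour_integral (circlepath 0 R) F = contour_integral (circlepath 0 R) (\<lambda>w. f w / (w - z) - f z * (1 / (w - z)))"
      using far R(1)[OF that] by (intro contour_integral_cong) (auto simp: F_def diff_divide_distrib)
    also have "\<dots> = C R - f z * (2 * of_real pi * \<i>)"
      unfolding C_def using ci one by (simp only: contour_integral_diff contour_integral_lmul contour_integrable_lmul)
    finally have "contour_integral (circlepath 0 R) F = C R - f z * (2 * of_real pi * \<i>)" .
    moreover have "(\<Sum>k<m. integral {0..2 * pi} (\<lambda>t. F (\<eta> k t) * \<eta>' k t)) = ?S"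
      by (intro sum.cong refl cS) auto
    ultimately have "?S + (C R - f z * (2 * of_real pi * \<i>)) = 0"
      using Cauchy_theorem_boundary[OF contF holF R(1,2)[OF that]] by (simp only:)
    moreover have "?S + C R = (?S + (C R - f z * (2 * of_real pi * \<i>))) + f z * (2 * of_real pi * \<i>)"
      by simp
    ultimately show ?thesis using True by simp
  qed
  have "((\<lambda>R. ?S + C R) \<longlongrightarrow> ?S + 0) at_top"
    by (intro tendsto_intros C_lim)
  moreover have "((\<lambda>R. ?S + C R) \<longlongrightarrow> (if z \<in> G then 2 * of_real pi * \<i> * f z else 0)) at_top"
    by (rule tendsto_eventually, rule eventually_mono[OF eventually_gt_at_top[of R0]]) (rule key)
  ultimately have "?S + 0 = (if z \<in> G then 2 * of_real pi * \<i> * f z else 0)"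
    by (intro tendsto_unique[OF trivial_limit_at_top_linorder])
  then show ?thesis by simp
qed

end

section \<open>The Cauchy kernel near a loop\<close>

context smooth_loop begin

text \<open>The curve is compared with its tangent line at \<open>s\<close>, whose kernel is
  \<open>1 / ((t - s) - i r)\<close> after cancelling \<open>g' s\<close>. The numerator of the
  difference is of order \<open>\<bar>t - s\<bar> * (\<bar>t - s\<bar> + \<bar>r\<bar>)\<close>,
  which is also a lower bound, up to a constant, for the product of the denominators. Hence
  \<open>B\<close> does not depend on \<open>r\<close>.\<close>

lemma Cauchy_kernel_bounds:
  assumes s: "s \<in> {0..2 * pi}"
  obtains r0 B where "r0 > 0" "B > 0"
    "\<And>t r. \<bar>t - s\<bar> \<le> pi \<Longrightarrow> \<bar>r\<bar> \<le> r0 \<Longrightarrow> t \<noteq> s \<or> r \<noteq> 0 \<Longrightarrow>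
       g t \<noteq> g s + \<i> * of_real r * g' s"
    "\<And>t r. \<bar>t - s\<bar> \<le> pi \<Longrightarrow> \<bar>r\<bar> \<le> r0 \<Longrightarrow> t \<noteq> s \<Longrightarrow>
       norm (g' t / (g t - (g s + \<i> * of_real r * g' s))) \<le> B / \<bar>t - s\<bar>"
    "\<And>t r. \<bar>t - s\<bar> \<le> pi \<Longrightarrow> \<bar>r\<bar> \<le> r0 \<Longrightarrow> t \<noteq> s \<Longrightarrow>
       norm (g' t / (g t - (g s + \<i> * of_real r * g' s)) - 1 / (of_real (t - s) - \<i> * of_real r)) \<le> B"
proof -
  obtain C where C: "C > 0"
    and C1: "\<And>s t. s \<in> {0..2 * pi} \<Longrightarrow> \<bar>t - s\<bar> \<le> pi \<Longrightarrow> norm (g' t - g' s) \<le> C * \<bar>t - s\<bar>"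
    and C2: "\<And>s t. s \<in> {0..2 * pi} \<Longrightarrow> \<bar>t - s\<bar> \<le> pi \<Longrightarrow>
       norm (g t - g s - (t - s) *\<^sub>R g' s) \<le> C * \<bar>t - s\<bar>\<^sup>2"
    using taylor_bounds by metis
  obtain c r0 where c: "c > 0" and r0: "r0 > 0" and sep:
    "\<And>s t r. s \<in> {0..2 * pi} \<Longrightarrow> \<bar>t - s\<bar> \<le> pi \<Longrightarrow> \<bar>r\<bar> \<le> r0 \<Longrightarrow>
       c * (\<bar>t - s\<bar> + \<bar>r\<bar>) \<le> norm (g t - (g s + \<i> * of_real r * g' s))"
    using normal_separation by metis
  have "bounded (g' ` {- pi..3 * pi})"
    using cont' by (intro compact_imp_bounded compact_continuous_image) auto
  then obtain M where M: "M > 0" "\<And>t. t \<in> {- pi..3 * pi} \<Longrightarrow> norm (g' t) \<le> M"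
    unfolding bounded_pos by auto
  define B where "B = max (M / c) (2 * C / c)"
  have B: "M / c \<le> B" "2 * C / c \<le> B" "B > 0"
    unfolding B_def using C M c by (auto simp: less_max_iff_disj)
  show thesis
  proof (rule that[OF r0 B(3)])
    fix t r :: real
    assume t: "\<bar>t - s\<bar> \<le> pi" and r: "\<bar>r\<bar> \<le> r0"
    define D where "D = g t - (g s + \<i> * of_real r * g' s)"
    have D: "c * (\<bar>t - s\<bar> + \<bar>r\<bar>) \<le> norm D"
      unfolding D_def by (rule sep[OF s t r])
    show "g t \<noteq> g s + \<i> * of_real r * g' s" if "t \<noteq> s \<or> r \<noteq> 0"
    proof -
      have "0 < c * (\<bar>t - s\<bar> + \<bar>r\<bar>)" using that c by (intro mult_pos_pos) auto
      then show ?thesis using D by (auto simp: D_def)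
    qed
    assume ts: "t \<noteq> s"
    have "t \<in> {- pi..3 * pi}" using s t by (auto simp: abs_if split: if_splits)
    have "c * \<bar>t - s\<bar> \<le> c * (\<bar>t - s\<bar> + \<bar>r\<bar>)" using c by simp
    then have "c * \<bar>t - s\<bar> \<le> norm D" using D by linarith
    then have "norm (g' t / D) \<le> M / (c * \<bar>t - s\<bar>)"
      unfolding norm_divide using M \<open>t \<in> _\<close> c ts by (intro frac_le) auto
    also have "\<dots> \<le> B / \<bar>t - s\<bar>"
      using divide_right_mono[OF B(1), of "\<bar>t - s\<bar>"] by simp
    finally show "norm (g' t / (g t - (g s + \<i> * of_real r * g' s))) \<le> B / \<bar>t - s\<bar>"
      unfolding D_def .
    define E where "E = of_real (t - s) - \<i> * of_real r"
    have E: "\<bar>t - s\<bar> \<le> norm E" using abs_Re_le_cmod[of E] by (simp add: E_def)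
    \<comment> \<open>This is \<open>g' t * E - D\<close>, rearranged so that the first-order terms
      have cancelled and each summand carries a Taylor or Lipschitz remainder.\<close>
    define N where "N = (g' t - g' s) * of_real (t - s) - (g t - g s - (t - s) *\<^sub>R g' s)
        - \<i> * of_real r * (g' t - g' s)"
    have "norm N \<le> norm (g' t - g' s) * \<bar>t - s\<bar> + norm (g t - g s - (t - s) *\<^sub>R g' s) + \<bar>r\<bar> * norm (g' t - g' s)"
    proof -
      have "norm N \<le> norm ((g' t - g' s) * of_real (t - s)) + norm (g t - g s - (t - s) *\<^sub>R g' s)
          + norm (\<i> * of_real r * (g' t - g' s))"
        unfolding N_def by (intro order_trans[OF norm_triangle_ineq4] add_right_mono norm_triangle_ineq4)
      then show ?thesis by (simp add: norm_mult flip: of_real_diff)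
    qed
    also have "\<dots> \<le> C * \<bar>t - s\<bar> * \<bar>t - s\<bar> + C * \<bar>t - s\<bar>\<^sup>2 + \<bar>r\<bar> * (C * \<bar>t - s\<bar>)"
      using C1[OF s t] C2[OF s t] by (intro add_mono mult_right_mono mult_left_mono) auto
    also have "\<dots> \<le> 2 * C * (\<bar>t - s\<bar> * (\<bar>t - s\<bar> + \<bar>r\<bar>))"
      using C by (simp add: algebra_simps power2_eq_square)
    finally have N: "norm N \<le> 2 * C * (\<bar>t - s\<bar> * (\<bar>t - s\<bar> + \<bar>r\<bar>))" .
    have pos: "0 < c * (\<bar>t - s\<bar> + \<bar>r\<bar>)" using ts c by (intro mult_pos_pos) auto
    then have "D \<noteq> 0" "E \<noteq> 0" using D E ts by auto
    then have "g' t / D - 1 / E = (g' t * E - D) / (D * E)" by (simp add: field_simps)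
    also have "g' t * E - D = N"
      by (simp add: N_def E_def D_def scaleR_conv_of_real algebra_simps)
    finally have "norm (g' t / D - 1 / E) = norm N / (norm D * norm E)"
      by (simp add: norm_divide norm_mult)
    also have "\<dots> \<le> 2 * C * (\<bar>t - s\<bar> * (\<bar>t - s\<bar> + \<bar>r\<bar>)) / (c * (\<bar>t - s\<bar> + \<bar>r\<bar>) * \<bar>t - s\<bar>)"
    proof (rule frac_le)
      show "c * (\<bar>t - s\<bar> + \<bar>r\<bar>) * \<bar>t - s\<bar> \<le> norm D * norm E"
        using D E pos by (intro mult_mono) auto
      show "0 < c * (\<bar>t - s\<bar> + \<bar>r\<bar>) * \<bar>t - s\<bar>" using mult_pos_pos[OF pos, of "\<bar>t - s\<bar>"] ts by simp
      show "0 \<le> 2 * C * (\<bar>t - s\<bar> * (\<bar>t - s\<bar> + \<bar>r\<bar>))" using C by simp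
    qed (rule N)
    also have "\<dots> = 2 * C / c"
    proof -
      have "2 * C * (x * y) / (c * y * x) = 2 * C / c" if "x > 0" "y > 0" for x y
        using that by simp
      from this[of "\<bar>t - s\<bar>" "\<bar>t - s\<bar> + \<bar>r\<bar>"] show ?thesis using ts by simp
    qed
    also have "\<dots> \<le> B" by (rule B)
    finally show "norm (g' t / (g t - (g s + \<i> * of_real r * g' s)) - 1 / (of_real (t - s) - \<i> * of_real r)) \<le> B"
      unfolding D_def E_def .
  qed
qed

text \<open>Averaging the Cauchy integral over the two points symmetric about the curve cancels the
  singular part, which is the odd function \<open>1 / (u - ir) + 1 / (u + ir)\<close> of \<open>u = t - s\<close>;
  what remains is dominated by an integrable function because \<open>\<phi>\<close> is Hoelder at \<open>s\<close>.\<close>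
lemma symmetric_Cauchy_integral_limit:
  assumes s: "s \<in> {0..2 * pi}" and cont\<phi>: "continuous_on UNIV \<phi>"
    and \<alpha>: "\<alpha> > 0" and holder: "\<And>t. \<bar>t - s\<bar> \<le> pi \<Longrightarrow> norm (\<phi> t - \<phi> s) \<le> C * \<bar>t - s\<bar> powr \<alpha>"
  defines "q \<equiv> \<lambda>t. \<phi> t * (g' t / (g t - g s)) - \<phi> s / of_real (t - s)"
  shows "q integrable_on {s - pi..s + pi}"
    and "\<exists>r0>0. \<forall>X. (\<forall>n. 0 < X n \<and> X n \<le> r0) \<longrightarrow> X \<longlonglongrightarrow> 0 \<longrightarrow>
      (\<lambda>n. integral {s - pi..s + pi} (\<lambda>t. \<phi> t * (g' t / (g t - (g s + \<i> * of_real (X n) * g' s))))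
         + integral {s - pi..s + pi} (\<lambda>t. \<phi> t * (g' t / (g t - (g s + \<i> * of_real (- X n) * g' s)))))
       \<longlonglongrightarrow> 2 * integral {s - pi..s + pi} q"
proof -
  obtain r0 B where r0: "r0 > 0" and B: "B > 0" and ne:
    "\<And>t r. \<bar>t - s\<bar> \<le> pi \<Longrightarrow> \<bar>r\<bar> \<le> r0 \<Longrightarrow> t \<noteq> s \<or> r \<noteq> 0 \<Longrightarrow> g t \<noteq> g s + \<i> * of_real r * g' s"
    and bound1: "\<And>t r. \<bar>t - s\<bar> \<le> pi \<Longrightarrow> \<bar>r\<bar> \<le> r0 \<Longrightarrow> t \<noteq> s \<Longrightarrow>
       norm (g' t / (g t - (g s + \<i> * of_real r * g' s))) \<le> B / \<bar>t - s\<bar>"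
    and bound2: "\<And>t r. \<bar>t - s\<bar> \<le> pi \<Longrightarrow> \<bar>r\<bar> \<le> r0 \<Longrightarrow> t \<noteq> s \<Longrightarrow>
       norm (g' t / (g t - (g s + \<i> * of_real r * g' s)) - 1 / (of_real (t - s) - \<i> * of_real r)) \<le> B"
    by (rule Cauchy_kernel_bounds[OF s]) (rule that; blast)
  define I where "I = {s - pi..s + pi}"
  have I: "\<bar>t - s\<bar> \<le> pi" if "t \<in> I" for t using that by (auto simp: I_def abs_if)
  define K where "K r t = \<phi> t * (g' t / (g t - (g s + \<i> * of_real r * g' s)))" for r t
  define W where "W r t = 1 / (of_real (t - s) - \<i> * of_real r) + 1 / (of_real (t - s) - \<i> * of_real (- r))" for r t
  \<comment> \<open>Twice the bound for one side: the Hoelder increment of \<open>\<phi>\<close>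
    times the pole, plus \<open>\<phi> s\<close> times the bounded deviation from the tangent
    kernel.\<close>
  define H where "H t = 2 * (C * B * \<bar>t - s\<bar> powr (\<alpha> - 1) + norm (\<phi> s) * B)" for t
  have intK: "K r integrable_on I" if "r \<noteq> 0" "\<bar>r\<bar> \<le> r0" for r
    unfolding K_def using ne[OF I] that unfolding I_def
    by (intro integrable_continuous_real continuous_intros cont cont' continuous_on_subset[OF cont\<phi>]) auto
  have nz: "of_real (t - s) - \<i> * of_real r \<noteq> 0" if "r \<noteq> 0" for t r
    using that by (simp add: complex_eq_iff)
  have contO: "continuous_on A (W r)" if "r \<noteq> 0" for r A
    unfolding W_def using nz[of r] nz[of "- r"] that by (intro continuous_intros) auto
  have intO: "integral I (W r) = 0" "W r integrable_on I" if "r \<noteq> 0" for r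
  proof -
    show int: "W r integrable_on I"
      unfolding I_def by (intro integrable_continuous_real contO that)
    have "integral {s - pi..s - 0} (W r) + integral {s + 0..s + pi} (W r) = 0"
    proof (rule integral_odd_about(2))
      \<comment> \<open>Reflection in \<open>s\<close> exchanges the two summands of
        \<open>W r\<close> up to sign.\<close>
      show "W r (2 * s - t) = - W r t" for t
        using nz[OF that, of t] nz[of "- r" t] nz[OF that, of "2 * s - t"] nz[of "- r" "2 * s - t"] that
        unfolding W_def by (simp add: divide_simps) (simp add: algebra_simps)
      show "W r integrable_on {s + 0..s + pi}"
        by (intro integrable_continuous_real contO that)
    qed
    then show "integral I (W r) = 0"
      using Henstock_Kurzweil_Integration.integral_combine[of "s - pi" s "s + pi" "W r"] int by (simp add: I_def)
  qed
  define h where "h r t = K r t + K (- r) t - \<phi> s * W r t" for r t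
  have int_h: "h r integrable_on I" "integral I (h r) = integral I (K r) + integral I (K (- r))"
    if "r \<noteq> 0" "\<bar>r\<bar> \<le> r0" for r
  proof -
    have "((\<lambda>t. K r t + K (- r) t - \<phi> s * W r t) has_integral
        integral I (K r) + integral I (K (- r)) - \<phi> s * 0) I"
      using intK[of r] intK[of "- r"] intO[of r] that
      by (intro has_integral_diff has_integral_add has_integral_mult_right) (auto simp: has_integral_iff)
    then show "h r integrable_on I" "integral I (h r) = integral I (K r) + integral I (K (- r))"
      unfolding h_def by (auto simp: has_integral_iff)
  qed
  have dom1: "norm (K r t - \<phi> s * (1 / (of_real (t - s) - \<i> * of_real r))) \<le> C * B * \<bar>t - s\<bar> powr (\<alpha> - 1) + norm (\<phi> s) * B"
    if t: "t \<in> I" "t \<noteq> s" and r: "\<bar>r\<bar> \<le> r0" for t r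
  proof -
    define \<kappa> where "\<kappa> = g' t / (g t - (g s + \<i> * of_real r * g' s))"
    define e where "e = 1 / (of_real (t - s) - \<i> * of_real r :: complex)"
    have "K r t - \<phi> s * e = (\<phi> t - \<phi> s) * \<kappa> + \<phi> s * (\<kappa> - e)"
      unfolding K_def \<kappa>_def[symmetric] by (simp add: algebra_simps)
    then have "norm (K r t - \<phi> s * e) \<le> norm (\<phi> t - \<phi> s) * norm \<kappa> + norm (\<phi> s) * norm (\<kappa> - e)"
      by (metis norm_mult norm_triangle_ineq)
    also have "\<dots> \<le> (C * \<bar>t - s\<bar> powr \<alpha>) * (B / \<bar>t - s\<bar>) + norm (\<phi> s) * B"
      unfolding \<kappa>_def e_def using holder[OF I[OF t(1)]] order_trans[OF norm_ge_zero holder[OF I[OF t(1)]]]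
        bound1[OF I[OF t(1)] r t(2)] bound2[OF I[OF t(1)] r t(2)]
      by (intro add_mono mult_mono mult_left_mono) auto
    also have "(C * \<bar>t - s\<bar> powr \<alpha>) * (B / \<bar>t - s\<bar>) = C * B * \<bar>t - s\<bar> powr (\<alpha> - 1)"
      using t(2) by (simp add: powr_diff)
    finally show ?thesis unfolding e_def .
  qed
  have dom: "norm (h r t) \<le> H t" if t: "t \<in> I - {s}" and r: "\<bar>r\<bar> \<le> r0" for t r
  proof -
    have "h r t = (K r t - \<phi> s * (1 / (of_real (t - s) - \<i> * of_real r)))
        + (K (- r) t - \<phi> s * (1 / (of_real (t - s) - \<i> * of_real (- r))))"
      by (simp add: h_def W_def algebra_simps)
    also have "norm \<dots> \<le> H t"
      unfolding H_def using dom1[of t r] dom1[of t "- r"] t r by (intro norm_triangle_le) auto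
    finally show ?thesis .
  qed
  \<comment> \<open>The kernel bounds require \<open>t \<noteq> s\<close>, so dominated convergence
    is run on the punctured window, which has the same integrals.\<close>
  have punct: "F integrable_on (I - {s}) \<longleftrightarrow> F integrable_on I" "integral (I - {s}) F = integral I F"
    for F :: "real \<Rightarrow> 'b::euclidean_space"
  proof -
    have neg: "negligible {x \<in> (I - {s}) - I. F x \<noteq> 0}" "negligible {x \<in> I - (I - {s}). F x \<noteq> 0}"
      by (auto intro: negligible_subset[of "{s}"])
    show "F integrable_on (I - {s}) \<longleftrightarrow> F integrable_on I"
      using neg by (intro iffI; elim integrable_spike_set; simp)
    show "integral (I - {s}) F = integral I F"
      using neg by (intro integral_spike_set)
  qed
  have intH: "H integrable_on (I - {s})"
    unfolding punct unfolding H_def I_def using \<alpha>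
    by (intro integrable_on_mult_right integrable_add integrable_abs_powr_about) auto
  have lim: "(\<lambda>n. h (X n) t) \<longlonglongrightarrow> 2 * q t" if t: "t \<in> I - {s}" and X: "X \<longlonglongrightarrow> 0" for X t
  proof -
    have gt: "g t \<noteq> g s" using ne[OF I, of t 0] t r0 by auto
    have Kl: "(\<lambda>n. K (Y n) t) \<longlonglongrightarrow> \<phi> t * (g' t / (g t - (g s + \<i> * of_real 0 * g' s)))" if "Y \<longlonglongrightarrow> 0" for Y
      unfolding K_def using gt that by (intro tendsto_intros) auto
    have Ol: "(\<lambda>n. 1 / (of_real (t - s) - \<i> * of_real (Y n))) \<longlonglongrightarrow> 1 / (of_real (t - s) - \<i> * of_real 0)"
      if "Y \<longlonglongrightarrow> (0::real)" for Y
      using t that by (intro tendsto_intros) auto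
    have X': "(\<lambda>n. - X n) \<longlonglongrightarrow> 0" using tendsto_minus[OF X] by simp
    have "(\<lambda>n. h (X n) t) \<longlonglongrightarrow> \<phi> t * (g' t / (g t - (g s + \<i> * of_real 0 * g' s)))
        + \<phi> t * (g' t / (g t - (g s + \<i> * of_real 0 * g' s)))
        - \<phi> s * (1 / (of_real (t - s) - \<i> * of_real 0) + 1 / (of_real (t - s) - \<i> * of_real 0))"
      unfolding h_def W_def by (intro tendsto_diff tendsto_add tendsto_mult_left Kl Ol X X')
    then show ?thesis by (simp add: q_def algebra_simps)
  qed
  have dct: "(\<lambda>t. 2 * q t) integrable_on (I - {s})"
      "(\<lambda>n. integral (I - {s}) (h (X n))) \<longlonglongrightarrow> integral (I - {s}) (\<lambda>t. 2 * q t)"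
    if X: "\<And>n. 0 < X n \<and> X n \<le> r0" "X \<longlonglongrightarrow> 0" for X
  proof -
    have X': "X n \<noteq> 0" "\<bar>X n\<bar> \<le> r0" for n using X(1)[of n] by auto
    have 1: "h (X n) integrable_on (I - {s})" for n
      unfolding punct by (rule int_h(1)[OF X'])
    have 2: "norm (h (X n) t) \<le> H t" if "t \<in> I - {s}" for n t
      by (rule dom[OF that X'(2)])
    show "(\<lambda>t. 2 * q t) integrable_on (I - {s})"
      by (rule dominated_convergence(1)[OF 1 intH 2 lim[OF _ X(2)]])
    show "(\<lambda>n. integral (I - {s}) (h (X n))) \<longlonglongrightarrow> integral (I - {s}) (\<lambda>t. 2 * q t)"
      by (rule dominated_convergence(2)[OF 1 intH 2 lim[OF _ X(2)]])
  qed
  \<comment> \<open>One concrete null sequence is enough to obtain integrability of \<open>q\<close>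
    as that of a dominated limit.\<close>
  have X0: "(\<lambda>n. r0 / real (Suc n)) \<longlonglongrightarrow> 0"
    using LIMSEQ_inverse_real_of_nat tendsto_mult_right_zero[of "\<lambda>n. inverse (real (Suc n))" sequentially r0]
    by (simp add: field_simps)
  have X1: "0 < r0 / real (Suc n) \<and> r0 / real (Suc n) \<le> r0" for n
    using r0 by (simp add: field_simps)
  have "(\<lambda>t. 2 * q t) integrable_on I"
    using dct(1)[OF X1 X0] unfolding punct .
  from integrable_on_mult_right[OF this, of "1 / 2"]
  show "q integrable_on {s - pi..s + pi}" by (simp add: I_def)
  have "(\<lambda>n. integral I (K (X n)) + integral I (K (- X n))) \<longlonglongrightarrow> 2 * integral I q"
    if X: "\<And>n. 0 < X n \<and> X n \<le> r0" "X \<longlonglongrightarrow> 0" for X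
  proof -
    have "integral I (h (X n)) = integral I (K (X n)) + integral I (K (- X n))" for n
      using X(1)[of n] by (intro int_h(2)) auto
    then show ?thesis using dct(2)[OF X] by (simp add: punct)
  qed
  then show "\<exists>r0>0. \<forall>X. (\<forall>n. 0 < X n \<and> X n \<le> r0) \<longrightarrow> X \<longlonglongrightarrow> 0 \<longrightarrow>
      (\<lambda>n. integral {s - pi..s + pi} (\<lambda>t. \<phi> t * (g' t / (g t - (g s + \<i> * of_real (X n) * g' s))))
         + integral {s - pi..s + pi} (\<lambda>t. \<phi> t * (g' t / (g t - (g s + \<i> * of_real (- X n) * g' s)))))
       \<longlonglongrightarrow> 2 * integral {s - pi..s + pi} q"
    using r0 unfolding I_def K_def by blast
qed

lemma Cauchy_integrable_off_point:
  assumes s: "s \<in> {0..2 * pi}" and cont\<phi>: "continuous_on UNIV \<phi>" and A: "{a..b} \<subseteq> {s - pi..s + pi} - {s}"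
  shows "(\<lambda>t. \<phi> t * (g' t / (g t - g s))) integrable_on {a..b}"
proof -
  have "g t \<noteq> g s" if "t \<in> {a..b}" for t
  proof
    assume "g t = g s"
    moreover have "\<bar>s - t\<bar> \<le> pi" "t \<noteq> s" using that A by (auto simp: abs_if subset_iff)
    ultimately show False using eq_imp_eq[of t s] pi_gt_zero by linarith
  qed
  then show ?thesis
    by (intro integrable_continuous_real continuous_intros cont cont' continuous_on_subset[OF cont\<phi>]) auto
qed

text \<open>On the symmetric window with its centre removed the odd term
  \<open>\<phi> s / (t - s)\<close> integrates to \<open>0\<close>, so the principal value is the
  ordinary integral of the regularised integrand.\<close>

lemma Cauchy_principal_value:
  assumes s: "s \<in> {0..2 * pi}" and cont\<phi>: "continuous_on UNIV \<phi>"
    and int: "(\<lambda>t. \<phi> t * (g' t / (g t - g s)) - \<phi> s / of_real (t - s)) integrable_on {s - pi..s + pi}"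
      (is "?q integrable_on _")
  shows "((\<lambda>e. integral ({s - pi..s - e} \<union> {s + e..s + pi}) (\<lambda>t. \<phi> t * (g' t / (g t - g s))))
           \<longlongrightarrow> integral {s - pi..s + pi} ?q) (at_right 0)"
proof -
  have "\<forall>\<^sub>F e in at_right 0. 0 < e \<and> e < pi"
    by (auto simp: eventually_at_right_field intro: exI[of _ pi])
  then have "\<forall>\<^sub>F e in at_right 0. integral ({s - pi..s - e} \<union> {s + e..s + pi}) ?q
      = integral ({s - pi..s - e} \<union> {s + e..s + pi}) (\<lambda>t. \<phi> t * (g' t / (g t - g s)))"
  proof eventually_elim
    case (elim e)
    define w :: "real \<Rightarrow> complex" where "w t = \<phi> s / of_real (t - s)" for t
    have w1: "w integrable_on {s + e..s + pi}"
      unfolding w_def using elim by (intro integrable_continuous_real continuous_intros) auto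
    have odd: "w (2 * s - t) = - w t" for t
      unfolding w_def by (simp add: minus_divide_right)
    note w2 = integral_odd_about[of w s e pi, OF odd w1]
    have w: "integral ({s - pi..s - e} \<union> {s + e..s + pi}) w = 0"
        "w integrable_on ({s - pi..s - e} \<union> {s + e..s + pi})"
      using integral_punctured[OF _ w2(1) w1] w2(2) elim by auto
    have p: "(\<lambda>t. \<phi> t * (g' t / (g t - g s))) integrable_on ({s - pi..s - e} \<union> {s + e..s + pi})"
      using elim by (intro integral_punctured(2) Cauchy_integrable_off_point s cont\<phi>) auto
    show ?case
      using Henstock_Kurzweil_Integration.integral_diff[OF p w(2)] w(1) by (simp add: w_def)
  qed
  then show ?thesis
    using integral_punctured_tendsto[OF int] Lim_transform_eventually by fastforce
qed

end

section \<open>Boundary values\<close>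

lemma integrable_bounded_punctured:
  fixes f :: "real \<Rightarrow> real"
  assumes cont: "continuous_on ({a..b} - {s}) f" and bound: "\<And>t. t \<in> {a..b} - {s} \<Longrightarrow> \<bar>f t\<bar> \<le> B"
  shows "f integrable_on {a..b}"
proof -
  have S: "{a..b} - {s} \<in> sets lebesgue" by simp
  have spike: "h integrable_on {a..b} - {s} \<longleftrightarrow> h integrable_on {a..b}" for h :: "real \<Rightarrow> real"
  proof -
    have "negligible {x \<in> ({a..b} - {s}) - {a..b}. h x \<noteq> 0}" "negligible {x \<in> {a..b} - ({a..b} - {s}). h x \<noteq> 0}"
      by (auto intro: negligible_subset[of "{s}"])
    then show ?thesis by (intro iffI; elim integrable_spike_set; simp)
  qed
  have "f integrable_on {a..b} - {s}"
  proof (rule measurable_bounded_by_integrable_imp_integrable[OF _ _ _ S])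
    show "f \<in> borel_measurable (lebesgue_on ({a..b} - {s}))"
      using cont S by (rule continuous_imp_measurable_on_sets_lebesgue)
    show "(\<lambda>_. B) integrable_on {a..b} - {s}" unfolding spike by (rule integrable_const_ivl)
    show "norm (f t) \<le> B" if "t \<in> {a..b} - {s}" for t using bound[OF that] by simp
  qed
  then show ?thesis by (simp only: spike)
qed

text \<open>The window around \<open>s\<close> may leave [0, 2 pi]. The increment is then split at
  the glued endpoints, where \<open>h 0 = h (2 * pi)\<close>; both pieces are no longer than
  \<open>\<bar>t - s\<bar>\<close>, which costs a factor 2.\<close>

lemma periodic_holder_at:
  fixes h :: "real \<Rightarrow> 'a::real_normed_vector"
  assumes "holder_on {0..2 * pi} h" and per: "\<And>t. h (t + 2 * pi) = h t" and s: "s \<in> {0..2 * pi}"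
  obtains C \<alpha> where "\<alpha> > 0" "\<And>t. \<bar>t - s\<bar> \<le> pi \<Longrightarrow> norm (h t - h s) \<le> C * \<bar>t - s\<bar> powr \<alpha>"
proof -
  obtain \<alpha> C where \<alpha>: "\<alpha> > 0" and hold: "\<And>s t. s \<in> {0..2 * pi} \<Longrightarrow> t \<in> {0..2 * pi} \<Longrightarrow> norm (h s - h t) \<le> C * \<bar>s - t\<bar> powr \<alpha>"
    using assms(1) unfolding holder_on_def by blast
  \<comment> \<open>\<open>holder_on\<close> fixes no sign for its constant, hence
    \<open>\<bar>C\<bar>\<close> in the monotonicity steps.\<close>
  have hold': "norm (h x - h y) \<le> \<bar>C\<bar> * d powr \<alpha>"
    if "x \<in> {0..2 * pi}" "y \<in> {0..2 * pi}" "\<bar>x - y\<bar> \<le> d" for x y d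
  proof -
    have "norm (h x - h y) \<le> C * \<bar>x - y\<bar> powr \<alpha>" by (rule hold[OF that(1,2)])
    also have "\<dots> \<le> \<bar>C\<bar> * \<bar>x - y\<bar> powr \<alpha>" by (intro mult_right_mono) auto
    also have "\<dots> \<le> \<bar>C\<bar> * d powr \<alpha>" using that(3) \<alpha> by (intro mult_left_mono powr_mono2) auto
    finally show ?thesis .
  qed
  have wrap: "norm (h x - h s) \<le> 2 * \<bar>C\<bar> * d powr \<alpha>"
    if "x \<in> {0..2 * pi}" "\<bar>x - p\<bar> \<le> d" "\<bar>p' - s\<bar> \<le> d" "{p, p'} \<subseteq> {0, 2 * pi}" for x p p' d
  proof -
    have "h p = h p'" using that(4) per[of 0] by auto
    then have "h x - h s = (h x - h p) + (h p' - h s)" by simp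
    also have "norm \<dots> \<le> \<bar>C\<bar> * d powr \<alpha> + \<bar>C\<bar> * d powr \<alpha>"
      using that s by (intro norm_triangle_mono hold') auto
    finally show ?thesis by simp
  qed
  have "norm (h t - h s) \<le> 2 * \<bar>C\<bar> * \<bar>t - s\<bar> powr \<alpha>" if t: "\<bar>t - s\<bar> \<le> pi" for t
  proof -
    consider "t < 0" | "t \<in> {0..2 * pi}" | "t > 2 * pi" by fastforce
    then show ?thesis
    proof cases
      case 1
      then show ?thesis
        using wrap[of "t + 2 * pi" "2 * pi" "\<bar>t - s\<bar>" 0] t s by (auto simp: per)
    next
      case 2
      have "\<bar>C\<bar> * \<bar>t - s\<bar> powr \<alpha> \<le> 2 * \<bar>C\<bar> * \<bar>t - s\<bar> powr \<alpha>" by (intro mult_right_mono) auto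
      then show ?thesis using hold'[OF 2 s order_refl] by linarith
    next
      case 3
      then show ?thesis
        using wrap[of "t - 2 * pi" 0 "\<bar>t - s\<bar>" "2 * pi"] t s per[of "t - 2 * pi"] by auto
    qed
  qed
  then show thesis using that \<alpha> by blast
qed

context smooth_loop begin

text \<open>Only the imaginary part of the kernel is integrable: its singular part \<open>1 / (t - s)\<close> is real.\<close>
lemma Neumann_kernel_integrable:
  assumes s: "s \<in> {0..2 * pi}" and der: "\<And>t. (a has_vector_derivative a' t) (at t)"
    and cont_a': "continuous_on UNIV a'" and nz: "\<And>t. a t \<noteq> 0" and cont\<mu>: "continuous_on UNIV \<mu>"
  shows "(\<lambda>t. Im (of_real (1 / pi) * (a s / a t) * (g' t / (g t - g s))) * \<mu> t) integrable_on {s - pi..s + pi}"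
    (is "?N integrable_on ?I")
proof -
  have conta: "continuous_on A a" for A
    using der by (meson continuous_at_imp_continuous_on has_vector_derivative_continuous)
  obtain r0 B where r0: "r0 > 0" and B: "B > 0" and ne:
    "\<And>t r. \<bar>t - s\<bar> \<le> pi \<Longrightarrow> \<bar>r\<bar> \<le> r0 \<Longrightarrow> t \<noteq> s \<or> r \<noteq> 0 \<Longrightarrow> g t \<noteq> g s + \<i> * of_real r * g' s"
    and bound1: "\<And>t r. \<bar>t - s\<bar> \<le> pi \<Longrightarrow> \<bar>r\<bar> \<le> r0 \<Longrightarrow> t \<noteq> s \<Longrightarrow>
       norm (g' t / (g t - (g s + \<i> * of_real r * g' s))) \<le> B / \<bar>t - s\<bar>"
    and bound2: "\<And>t r. \<bar>t - s\<bar> \<le> pi \<Longrightarrow> \<bar>r\<bar> \<le> r0 \<Longrightarrow> t \<noteq> s \<Longrightarrow>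
       norm (g' t / (g t - (g s + \<i> * of_real r * g' s)) - 1 / (of_real (t - s) - \<i> * of_real r)) \<le> B"
    by (rule Cauchy_kernel_bounds[OF s]) (rule that; blast)
  obtain L where L: "L > 0" "\<And>s' t. s' \<in> ?I \<Longrightarrow> t \<in> ?I \<Longrightarrow> norm (a t - a s') \<le> L * \<bar>t - s'\<bar>"
    using C1_imp_Lipschitz[OF der continuous_on_subset[OF cont_a' subset_UNIV]] by metis
  have "continuous_on ?I (\<lambda>t. norm (a t))" by (intro continuous_intros conta)
  from continuous_attains_inf[OF _ _ this]
  obtain t0 where t0: "\<And>t. t \<in> ?I \<Longrightarrow> norm (a t0) \<le> norm (a t)" by fastforce
  have "continuous_on ?I (\<lambda>t. \<bar>\<mu> t\<bar>)" by (intro continuous_intros continuous_on_subset[OF cont\<mu>]) auto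
  from continuous_attains_sup[OF _ _ this]
  obtain t1 where t1: "\<And>t. t \<in> ?I \<Longrightarrow> \<bar>\<mu> t\<bar> \<le> \<bar>\<mu> t1\<bar>" by fastforce
  show ?thesis
  proof (rule integrable_bounded_punctured)
    have gne: "g t \<noteq> g s" if "t \<in> ?I - {s}" for t
      using ne[of t 0] that r0 by (auto simp: abs_if)
    show "continuous_on (?I - {s}) ?N"
      using gne nz
      by (intro continuous_intros cont cont' conta continuous_on_subset[OF cont\<mu>]) auto
    fix t assume t: "t \<in> ?I - {s}"
    then have ts: "\<bar>t - s\<bar> \<le> pi" "t \<noteq> s" by (auto simp: abs_if)
    define \<kappa> where "\<kappa> = g' t / (g t - g s)"
    have \<kappa>: "norm \<kappa> \<le> B / \<bar>t - s\<bar>" "norm (\<kappa> - 1 / of_real (t - s)) \<le> B"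
      using bound1[OF ts(1) _ ts(2), of 0] bound2[OF ts(1) _ ts(2), of 0] r0 by (auto simp: \<kappa>_def)
    \<comment> \<open>Subtracting the real pole leaves the imaginary part unchanged.\<close>
    have "Im (of_real (1 / pi) * w) = Im (w - 1 / of_real (t - s)) / pi" for w
    proof -
      have "Im (1 / of_real (t - s)) = 0" by (metis Im_complex_of_real of_real_1 of_real_divide)
      then show ?thesis by simp
    qed
    from this[of "a s / a t * \<kappa>"]
    have "Im (of_real (1 / pi) * (a s / a t) * \<kappa>) = Im (a s / a t * \<kappa> - 1 / of_real (t - s)) / pi"
      by (simp only: mult.assoc)
    also have "\<bar>\<dots>\<bar> \<le> norm (a s / a t * \<kappa> - 1 / of_real (t - s)) / pi"
      unfolding abs_divide abs_of_pos[OF pi_gt_zero] by (rule divide_right_mono[OF abs_Im_le_cmod pi_ge_zero])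
    \<comment> \<open>The Lipschitz increment of \<open>a\<close> cancels the simple pole of
      \<open>\<kappa>\<close>; the second summand is bounded by comparison with the tangent
      line.\<close>
    also have "a s / a t * \<kappa> - 1 / of_real (t - s) = (a s - a t) / a t * \<kappa> + (\<kappa> - 1 / of_real (t - s))"
      using nz[of t] by (simp add: diff_divide_distrib algebra_simps)
    also have "norm \<dots> \<le> (L * \<bar>t - s\<bar> / norm (a t0)) * (B / \<bar>t - s\<bar>) + B"
    proof (intro norm_triangle_mono \<kappa>)
      have "norm (a s - a t) \<le> L * \<bar>t - s\<bar>"
        using L(2)[of s t] t by (simp add: norm_minus_commute)
      then have "norm ((a s - a t) / a t) \<le> L * \<bar>t - s\<bar> / norm (a t0)"
        unfolding norm_divide using t0[of t] t nz L(1) by (intro frac_le) auto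
      then show "norm ((a s - a t) / a t * \<kappa>) \<le> (L * \<bar>t - s\<bar> / norm (a t0)) * (B / \<bar>t - s\<bar>)"
        unfolding norm_mult using \<kappa>(1) L(1) by (intro mult_mono) auto
    qed
    also have "(L * \<bar>t - s\<bar> / norm (a t0)) * (B / \<bar>t - s\<bar>) + B = L * B / norm (a t0) + B"
      using ts by simp
    finally have "\<bar>Im (of_real (1 / pi) * (a s / a t) * \<kappa>)\<bar> \<le> (L * B / norm (a t0) + B) / pi"
      by (simp add: divide_right_mono)
    then show "\<bar>?N t\<bar> \<le> (L * B / norm (a t0) + B) / pi * \<bar>\<mu> t1\<bar>"
      unfolding abs_mult \<kappa>_def[symmetric] using t1[of t] t by (intro mult_mono) auto
  qed
qed

end

section \<open>The principal value of the Cauchy integral over the whole boundary\<close>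

context smooth_region begin

lemma continuous_on_boundary_values:
  assumes "continuous_on (closure G) f" "k < m"
  shows "continuous_on A (\<lambda>t. f (\<eta> k t))"
  using smooth_loop.in_curve[OF loop, OF assms(2)] curve_subset_closure[OF assms(2)]
  by (intro continuous_on_compose2[OF assms(1)] smooth_loop.cont[OF loop, OF assms(2)]) blast

lemma continuous_on_Cauchy_integrand:
  assumes "continuous_on (closure G) f" "k < m" "z \<notin> curve k"
  shows "continuous_on A (\<lambda>t. f (\<eta> k t) * (\<eta>' k t / (\<eta> k t - z)))"
  using smooth_loop.in_curve[OF loop, OF assms(2)] assms(3)
  by (intro continuous_intros continuous_on_boundary_values[OF assms(1,2)]
      smooth_loop.cont[OF loop, OF assms(2)] smooth_loop.cont'[OF loop, OF assms(2)]) auto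

lemma Cauchy_integral_centered:
  assumes "continuous_on (closure G) f" "k < m" "z \<notin> curve k" "s \<in> {0..2 * pi}"
  shows "integral {0..2 * pi} (\<lambda>t. f (\<eta> k t) * (\<eta>' k t / (\<eta> k t - z)))
       = integral {s - pi..s + pi} (\<lambda>t. f (\<eta> k t) * (\<eta>' k t / (\<eta> k t - z)))"
  using smooth_loop.periodic[OF loop, OF assms(2)] smooth_loop.periodic'[OF loop, OF assms(2)]
  by (intro integral_centered_period(2) assms integrable_continuous_real
      continuous_on_Cauchy_integrand) auto

text \<open>Only the curve through the point is singular. On the others the Cauchy integral is
  continuous in the evaluation point, so both pushed values have the same limit, and every curve
  contributes \<open>2 * \<Lambda> k\<close>.\<close>

lemma Cauchy_principal_value_boundary:
  assumes contf: "continuous_on (closure G) f" and holf: "f holomorphic_on G"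
    and inf: "(f \<longlongrightarrow> 0) at_infinity" and j: "j < m" and s: "s \<in> {0..2 * pi}"
    and \<alpha>: "\<alpha> > 0"
    and holder: "\<And>t. \<bar>t - s\<bar> \<le> pi \<Longrightarrow> norm (f (\<eta> j t) - f (\<eta> j s)) \<le> C * \<bar>t - s\<bar> powr \<alpha>"
  shows "((\<lambda>e. \<Sum>k<m. integral ({s - pi..s - e} \<union> {s + e..s + pi})
            (\<lambda>t. f (\<eta> k t) * (\<eta>' k t / (\<eta> k t - \<eta> j s)))) \<longlongrightarrow> of_real pi * \<i> * f (\<eta> j s)) (at_right 0)"
proof -
  interpret J: smooth_loop "\<eta> j" "\<eta>' j" "\<eta>'' j" by (rule loop[OF j])
  define F where "F k z = (\<lambda>t. f (\<eta> k t) * (\<eta>' k t / (\<eta> k t - z)))" for k z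
  define q where "q = (\<lambda>t. f (\<eta> j t) * (\<eta>' j t / (\<eta> j t - \<eta> j s)) - f (\<eta> j s) / of_real (t - s))"
  define z0 where "z0 = \<eta> j s"
  define \<Lambda> where "\<Lambda> k = (if k = j then integral {s - pi..s + pi} q else integral {s - pi..s + pi} (F k z0))" for k
  note contj = continuous_on_boundary_values[OF contf j, of UNIV]
  have int_q: "q integrable_on {s - pi..s + pi}"
    unfolding q_def by (rule J.symmetric_Cauchy_integral_limit(1)[OF s contj \<alpha> holder])
  obtain r0 where r0: "r0 > 0" and lim_j: "\<And>X. (\<forall>n. 0 < X n \<and> X n \<le> r0) \<Longrightarrow> X \<longlonglongrightarrow> 0 \<Longrightarrow>
      (\<lambda>n. integral {s - pi..s + pi} (F j (push j (X n) s)) + integral {s - pi..s + pi} (F j (push j (- X n) s)))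
        \<longlonglongrightarrow> 2 * integral {s - pi..s + pi} q"
    using J.symmetric_Cauchy_integral_limit(2)[OF s contj \<alpha> holder] unfolding F_def q_def by blast
  obtain \<rho> \<sigma> where \<rho>: "\<rho> > 0" and \<sigma>: "\<And>k. k < m \<Longrightarrow> \<sigma> k \<in> {1, - 1 :: real}"
    and in_G: "\<And>k. k < m \<Longrightarrow> collar k \<rho> (\<sigma> k) \<subseteq> G"
    and in_hole: "\<And>k. k < m \<Longrightarrow> collar k \<rho> (- \<sigma> k) \<subseteq> hole k"
    using one_sided_collars by metis
  have push_G: "push j (\<sigma> j * r) s \<in> G" and push_hole: "push j (- \<sigma> j * r) s \<in> hole j"
    if "0 < r" "r < \<rho>" for r
    using in_G[OF j] in_hole[OF j] push_in_collar[OF s that] by blast+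
  have push_off: "push j r s \<notin> frontier G" if r: "r \<noteq> 0" "\<bar>r\<bar> < \<rho>" for r
  proof -
    have "push j r s \<in> G \<or> push j r s \<in> hole j"
      using push_G[of "\<bar>r\<bar>"] push_hole[of "\<bar>r\<bar>"] r \<sigma>[OF j] by (auto simp: abs_if split: if_splits)
    then show ?thesis
      using hole_not_closure_G[OF j] open_G by (auto simp: frontier_def interior_open)
  qed
  have push_off_k: "push j r s \<notin> curve k" if "k < m" "k \<noteq> j" "\<bar>r\<bar> < \<rho>" for r k
  proof (cases "r = 0")
    case True
    then show ?thesis using J.in_curve[of s] disjoint[OF j that(1)] that(2) by auto
  next
    case False
    then show ?thesis using push_off[OF False that(3)] that(1) frontier_G by blast
  qed
  \<comment> \<open>Small enough both for the limit on curve \<open>j\<close> and for the pushed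
    points to stay in the collars.\<close>
  define r1 where "r1 = min r0 (\<rho> / 2)"
  have r1: "0 < r1" "r1 \<le> r0" "r1 \<le> \<rho> / 2" "r1 < \<rho>" using r0 \<rho> by (auto simp: r1_def)
  define X where "X n = r1 / real (Suc n)" for n
  have X0: "X \<longlonglongrightarrow> 0"
    unfolding X_def
    using LIMSEQ_inverse_real_of_nat tendsto_mult_right_zero[of "\<lambda>n. inverse (real (Suc n))" sequentially r1]
    by (simp add: field_simps)
  have X1: "0 < X n" "X n \<le> r1" for n
    using r1 by (auto simp: X_def field_simps)
  have X_minus: "(\<lambda>n. - X n) \<longlonglongrightarrow> 0" using tendsto_minus[OF X0] by simp
  have lim_k: "(\<lambda>n. integral {0..2 * pi} (F k (push j (Y n) s))) \<longlonglongrightarrow> integral {0..2 * pi} (F k z0)"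
    if k: "k < m" "k \<noteq> j" and Y: "Y \<longlonglongrightarrow> 0" "\<And>n. Y n \<in> {- r1..r1}" for k Y
  proof -
    interpret K: smooth_loop "\<eta> k" "\<eta>' k" "\<eta>'' k" by (rule loop[OF k(1)])
    have ne: "\<eta> k t \<noteq> push j r s" if "r \<in> {- r1..r1}" for r t
      using push_off_k[OF k, of r] K.in_curve[of t] that r1 by (auto simp: abs_if)
    have "continuous_on ({- r1..r1} \<times> {0..2 * pi}) (\<lambda>p. F k (push j (fst p) s) (snd p))"
      unfolding F_def
      by (intro continuous_intros continuous_on_compose2[OF continuous_on_boundary_values[OF contf k(1), of UNIV]]
          continuous_on_compose2[OF K.cont[of UNIV]] continuous_on_compose2[OF K.cont'[of UNIV]])
         (use ne in auto)
    then have "continuous_on {- r1..r1} (\<lambda>r. integral {0..2 * pi} (F k (push j r s)))"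
      using integral_continuous_on_param[of "{- r1..r1}" 0 "2 * pi" "\<lambda>r. F k (push j r s)"]
      by (simp add: case_prod_unfold)
    from continuous_on_tendsto_compose[OF this Y(1)] Y(2) r1(1)
    have "(\<lambda>n. integral {0..2 * pi} (F k (push j (Y n) s))) \<longlonglongrightarrow> integral {0..2 * pi} (F k (push j 0 s))"
      by auto
    then show ?thesis by (simp add: z0_def)
  qed
  have lim: "(\<lambda>n. integral {0..2 * pi} (F k (push j (X n) s)) + integral {0..2 * pi} (F k (push j (- X n) s)))
      \<longlonglongrightarrow> 2 * \<Lambda> k" if k: "k < m" for k
  proof (cases "k = j")
    case True
    have "integral {0..2 * pi} (F j (push j r s)) = integral {s - pi..s + pi} (F j (push j r s))"
      if "r = X n \<or> r = - X n" for r n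
    proof -
      have "push j r s \<notin> curve j"
        using push_off[of r] X1[of n] r1 that j unfolding frontier_G by auto
      then show ?thesis unfolding F_def by (intro Cauchy_integral_centered contf j s)
    qed
    then have "integral {0..2 * pi} (F j (push j (X n) s)) + integral {0..2 * pi} (F j (push j (- X n) s))
      = integral {s - pi..s + pi} (F j (push j (X n) s)) + integral {s - pi..s + pi} (F j (push j (- X n) s))" for n
      by metis
    moreover have "(\<lambda>n. integral {s - pi..s + pi} (F j (push j (X n) s)) + integral {s - pi..s + pi} (F j (push j (- X n) s)))
        \<longlonglongrightarrow> 2 * integral {s - pi..s + pi} q"
      using X1 r1 by (intro lim_j X0) (auto intro: order_trans)
    ultimately show ?thesis using True by (simp add: \<Lambda>_def)
  next
    case False
    have X2: "X n \<in> {- r1..r1}" "- X n \<in> {- r1..r1}" for n using X1[of n] r1(1) by auto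
    have z0: "z0 \<notin> curve k" using push_off_k[OF k False, of 0] \<rho> by (simp add: z0_def)
    have "(\<lambda>n. integral {0..2 * pi} (F k (push j (X n) s)) + integral {0..2 * pi} (F k (push j (- X n) s)))
      \<longlonglongrightarrow> integral {0..2 * pi} (F k z0) + integral {0..2 * pi} (F k z0)"
      by (intro tendsto_add lim_k[OF k False X0 X2(1)] lim_k[OF k False X_minus X2(2)])
    moreover have "integral {0..2 * pi} (F k z0) = \<Lambda> k"
      using False Cauchy_integral_centered[OF contf k z0 s] by (simp add: \<Lambda>_def F_def)
    ultimately show ?thesis by simp
  qed
  have "(\<lambda>n. \<Sum>k<m. integral {0..2 * pi} (F k (push j (X n) s)) + integral {0..2 * pi} (F k (push j (- X n) s)))
      \<longlonglongrightarrow> (\<Sum>k<m. 2 * \<Lambda> k)"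
    by (intro tendsto_sum lim) auto
  \<comment> \<open>One pushed point is in \<open>G\<close> and the other in the hole, so a single
    value of \<open>f\<close> survives. Flipping \<open>\<sigma> j\<close> only swaps the two
    summands on the left.\<close>
  moreover have "(\<Sum>k<m. integral {0..2 * pi} (F k (push j (X n) s)) + integral {0..2 * pi} (F k (push j (- X n) s)))
      = 2 * of_real pi * \<i> * f (push j (\<sigma> j * X n) s)" for n
  proof -
    have off: "push j (\<sigma> j * X n) s \<notin> frontier G" "push j (- \<sigma> j * X n) s \<notin> frontier G"
      using X1[of n] r1 \<sigma>[OF j] by (intro push_off; auto)+
    have G: "push j (\<sigma> j * X n) s \<in> G" "push j (- \<sigma> j * X n) s \<notin> G"
      using push_G[of "X n"] push_hole[of "X n"] X1[of n] r1 hole_not_closure_G[OF j] closure_subset[of G] by auto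
    have "(\<Sum>k<m. integral {0..2 * pi} (F k (push j (X n) s))) + (\<Sum>k<m. integral {0..2 * pi} (F k (push j (- X n) s)))
      = (\<Sum>k<m. integral {0..2 * pi} (F k (push j (\<sigma> j * X n) s))) + (\<Sum>k<m. integral {0..2 * pi} (F k (push j (- \<sigma> j * X n) s)))"
      using \<sigma>[OF j] by (auto simp: add.commute)
    also have "\<dots> = 2 * of_real pi * \<i> * f (push j (\<sigma> j * X n) s)"
      using Cauchy_formula_boundary[OF contf holf inf off(1)] Cauchy_formula_boundary[OF contf holf inf off(2)] G
      unfolding F_def by simp
    finally show ?thesis by (simp add: sum.distrib)
  qed
  moreover have "(\<lambda>n. 2 * of_real pi * \<i> * f (push j (\<sigma> j * X n) s)) \<longlonglongrightarrow> 2 * of_real pi * \<i> * f z0"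
  proof (intro tendsto_mult_left continuous_on_tendsto_compose[OF contf])
    have "(\<lambda>n. push j (\<sigma> j * X n) s) \<longlonglongrightarrow> push j (\<sigma> j * 0) s"
      by (intro tendsto_intros X0)
    then show "(\<lambda>n. push j (\<sigma> j * X n) s) \<longlonglongrightarrow> z0" by (simp add: z0_def)
    show "z0 \<in> closure G" unfolding z0_def using J.in_curve curve_subset_closure[OF j] by blast
    show "\<forall>\<^sub>F n in sequentially. push j (\<sigma> j * X n) s \<in> closure G"
      using push_G X1 r1 closure_subset[of G] by (intro always_eventually allI) (meson le_less_trans subsetD)
  qed
  ultimately have "(\<Sum>k<m. 2 * \<Lambda> k) = 2 * of_real pi * \<i> * f z0"
    by (simp only: LIMSEQ_unique)
  then have sum: "(\<Sum>k<m. \<Lambda> k) = of_real pi * \<i> * f z0"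
    by (simp flip: sum_distrib_left)
  \<comment> \<open>The numbers \<open>\<Lambda> k\<close>, whose sum was found from points off the
    boundary, are also the limits of the truncated integrals on it.\<close>
  have "((\<lambda>e. integral ({s - pi..s - e} \<union> {s + e..s + pi}) (F k z0)) \<longlongrightarrow> \<Lambda> k) (at_right 0)" if k: "k < m" for k
  proof (cases "k = j")
    case True
    then show ?thesis
      using J.Cauchy_principal_value[OF s contj int_q[unfolded q_def]]
      by (simp add: \<Lambda>_def F_def z0_def q_def)
  next
    case False
    have z0: "z0 \<notin> curve k" using push_off_k[OF k False, of 0] \<rho> by (simp add: z0_def)
    have "F k z0 integrable_on {s - pi..s + pi}"
      unfolding F_def by (intro integrable_continuous_real continuous_on_Cauchy_integrand contf k z0)
    then show ?thesis
      using integral_punctured_tendsto[of "F k z0" s pi] False by (simp add: \<Lambda>_def)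
  qed
  then have "((\<lambda>e. \<Sum>k<m. integral ({s - pi..s - e} \<union> {s + e..s + pi}) (F k z0)) \<longlongrightarrow> (\<Sum>k<m. \<Lambda> k)) (at_right 0)"
    by (intro tendsto_sum) auto
  then show ?thesis unfolding sum F_def z0_def .
qed

end

section \<open>From the principal value of the Cauchy integral to the integral equation\<close>

theorem theorem3p3:
  fixes m :: nat
    and \<eta> :: "nat \<Rightarrow> real \<Rightarrow> complex"
    and G :: "complex set"
    and Af :: "complex \<Rightarrow> complex"
    and \<gamma> :: "nat \<Rightarrow> real \<Rightarrow> real"
    and f :: "complex \<Rightarrow> complex"
  assumes m_pos: "m \<ge> 1"
    and eta_per: "\<And>k t. k < m \<Longrightarrow> \<eta> k (t + 2*pi) = \<eta> k t"
    and eta_C2: "\<And>k. k < m \<Longrightarrow> C2_fun (\<eta> k)"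
    and eta_deriv_nz: "\<And>k t. k < m \<Longrightarrow> vector_derivative (\<eta> k) (at t) \<noteq> 0"
    and eta_simple: "\<And>k. k < m \<Longrightarrow> inj_on (\<eta> k) {0..<2*pi}"
    and eta_disjoint: "\<And>j k. j < m \<Longrightarrow> k < m \<Longrightarrow> j \<noteq> k \<Longrightarrow>
                         \<eta> j ` {0..2*pi} \<inter> \<eta> k ` {0..2*pi} = {}"
    and G_open: "open G" and G_conn: "connected G"
    and G_unbounded: "bounded (- G)"
    and G_zero: "0 \<in> G"
    and G_boundary: "frontier G = (\<Union>k<m. \<eta> k ` {0..2*pi})"
    and clockwise: "\<And>k z. k < m \<Longrightarrow> z \<notin> path_image (bpath (\<eta> k)) \<Longrightarrow>
                      winding_number (bpath (\<eta> k)) z \<in> {0, -1}"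
    and G_left: "\<And>k z. k < m \<Longrightarrow> z \<in> G \<Longrightarrow> winding_number (bpath (\<eta> k)) z = 0"
    and A_nz: "\<And>z. z \<in> frontier G \<Longrightarrow> Af z \<noteq> 0"
    and A_C1: "\<And>k. k < m \<Longrightarrow> C1_fun (\<lambda>t. Af (\<eta> k t))"
    and gamma_H: "\<And>k. k < m \<Longrightarrow> in_H (\<gamma> k)"
    and f_hol: "f holomorphic_on G"
    and f_inf: "(f \<longlongrightarrow> 0) at_infinity"
    and f_cont: "continuous_on (closure G) f"
    and f_bdry_holder: "\<And>k. k < m \<Longrightarrow> holder_on {0..2*pi} (\<lambda>t. f (\<eta> k t))"
    and RH: "\<And>k t. k < m \<Longrightarrow> Re (Af (\<eta> k t) * f (\<eta> k t)) = \<gamma> k t"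
  shows "\<forall>j<m. \<forall>s\<in>{0..2*pi}.
           (let \<mu> = (\<lambda>k t. Im (Af (\<eta> k t) * f (\<eta> k t))) in
             Mop_pv m Af \<eta> \<gamma> j s (- (\<mu> j s - Nop m Af \<eta> \<mu> j s)))"

proof -
  \<comment> \<open>The kernel is written with \<open>vector_derivative\<close>, while
    \<open>C2_fun\<close> only asserts that some derivatives exist; uniqueness identifies the
    two.\<close>
  define \<eta>' where "\<eta>' k t = vector_derivative (\<eta> k) (at t)" for k t
  have "\<exists>g2. (\<forall>t. (\<eta> k has_vector_derivative \<eta>' k t) (at t)) \<and>
      (\<forall>t. (\<eta>' k has_vector_derivative g2 t) (at t)) \<and> continuous_on UNIV g2" if k: "k < m" for k
  proof -
    obtain g1 g2 where g1: "\<And>t. (\<eta> k has_vector_derivative g1 t) (at t)"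
      and g2: "\<And>t. (g1 has_vector_derivative g2 t) (at t)" "continuous_on UNIV g2"
      using eta_C2[OF k] unfolding C2_fun_def by blast
    have "\<eta>' k = g1"
      using g1 by (simp add: \<eta>'_def fun_eq_iff vector_derivative_at)
    then show ?thesis using g1 g2 by blast
  qed
  then obtain \<eta>'' where der: "\<And>k. k < m \<Longrightarrow> (\<forall>t. (\<eta> k has_vector_derivative \<eta>' k t) (at t)) \<and>
      (\<forall>t. (\<eta>' k has_vector_derivative \<eta>'' k t) (at t)) \<and> continuous_on UNIV (\<eta>'' k)"
    by metis
  interpret smooth_region m \<eta> \<eta>' \<eta>'' G
  proof (rule smooth_region.intro)
    show "smooth_loop (\<eta> k) (\<eta>' k) (\<eta>'' k)" if "k < m" for k
      using der[OF that] eta_per[OF that] eta_simple[OF that] eta_deriv_nz[OF that]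
      by unfold_locales (auto simp: \<eta>'_def)
    show "path_image (bpath (\<eta> j)) \<inter> path_image (bpath (\<eta> k)) = {}"
      if "j < m" "k < m" "j \<noteq> k" for j k
      using eta_disjoint[OF that] by (simp add: path_image_bpath)
    show "frontier G = (\<Union>k<m. path_image (bpath (\<eta> k)))"
      using G_boundary by (simp add: path_image_bpath)
  qed (use G_open G_conn G_zero G_unbounded clockwise G_left in auto)
  have nz: "Af (\<eta> k t) \<noteq> 0" if "k < m" for k t
    using A_nz smooth_loop.in_curve[OF loop, OF that, of t] that frontier_G by blast
  have cont_A: "continuous_on UNIV (\<lambda>t. Af (\<eta> k t))" if "k < m" for k
    using A_C1[OF that] unfolding C1_fun_def
    by (meson continuous_at_imp_continuous_on has_vector_derivative_continuous)
  show ?thesis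
  proof (unfold Let_def, intro allI impI ballI)
    fix j s assume j: "j < m" and s: "s \<in> {0..2 * pi}"
    define z0 where "z0 = \<eta> j s"
    define \<mu> where "\<mu> = (\<lambda>k t. Im (Af (\<eta> k t) * f (\<eta> k t)))"
    define F where "F k = (\<lambda>t. f (\<eta> k t) * (\<eta>' k t / (\<eta> k t - z0)))" for k
    define N where "N k = (\<lambda>t. Nker Af \<eta> j s k t * \<mu> k t)" for k
    define T where "T e = {s - pi..s - e} \<union> {s + e..s + pi}" for e
    have kernel: "kernel Af \<eta> j s k t = of_real (1 / pi) * (Af z0 / Af (\<eta> k t)) * (\<eta>' k t / (\<eta> k t - z0))" for k t
      by (simp add: kernel_def z0_def \<eta>'_def)
    have cont_\<mu>: "continuous_on UNIV (\<mu> k)" if "k < m" for k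
      unfolding \<mu>_def by (intro continuous_intros cont_A continuous_on_boundary_values f_cont that)
    have off: "\<eta> k t \<noteq> z0" if "k < m" "k \<noteq> j" for k t
      using disjoint[OF that(1) j that(2)] smooth_loop.in_curve[OF loop] that(1) j
      unfolding z0_def by (metis disjoint_iff)
    have int_N: "N k integrable_on {s - pi..s + pi}" if k: "k < m" for k
    proof (cases "k = j")
      case True
      obtain a' where "\<And>t. ((\<lambda>t. Af (\<eta> j t)) has_vector_derivative a' t) (at t)" "continuous_on UNIV a'"
        using A_C1[OF j] unfolding C1_fun_def by blast
      from smooth_loop.Neumann_kernel_integrable[OF loop[OF j] s this nz[OF j] cont_\<mu>[OF j]]
      show ?thesis unfolding True N_def Nker_def kernel z0_def .
    next
      case False
      show ?thesis
        unfolding N_def Nker_def kernel using off[OF k False] nz[OF k]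
        by (intro integrable_continuous_real continuous_intros continuous_on_subset[OF cont_A[OF k]]
            continuous_on_subset[OF cont_\<mu>[OF k]] smooth_loop.cont[OF loop[OF k]]
            smooth_loop.cont'[OF loop[OF k]]) auto
    qed
    have Nop: "Nop m Af \<eta> \<mu> j s = (\<Sum>k<m. integral {s - pi..s + pi} (N k))"
      unfolding Nop_def
    proof (intro sum.cong refl)
      fix k assume "k \<in> {..<m}"
      then have k: "k < m" by simp
      have "N k (t + 2 * pi) = N k t" for t
        unfolding N_def Nker_def kernel \<mu>_def
        by (simp add: eta_per[OF k] smooth_loop.periodic'[OF loop[OF k]])
      from integral_centered_period(2)[OF this s int_N[OF k]]
      show "integral {0..2 * pi} (\<lambda>t. Nker Af \<eta> j s k t * \<mu> k t) = integral {s - pi..s + pi} (N k)"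
        by (simp add: N_def)
    qed
    have int_F: "F k integrable_on {a..b}" if "k < m" "{a..b} \<subseteq> {s - pi..s + pi} - {s}" for k a b
    proof (cases "k = j")
      case True
      then show ?thesis unfolding F_def z0_def
        using smooth_loop.Cauchy_integrable_off_point[OF loop[OF j] s continuous_on_boundary_values[OF f_cont j] that(2)]
        by simp
    next
      case False
      have "z0 \<notin> curve k"
        using off[OF that(1) False] by (auto simp: path_image_bpath)
      then show ?thesis
        unfolding F_def by (intro integrable_continuous_real continuous_on_Cauchy_integrand f_cont that(1))
    qed
    \<comment> \<open>For \<open>k = j\<close> the Cauchy integrand may have a pole at
      \<open>s\<close>, so the real part is taken on the truncated window, before the limit.\<close>
    have split: "integral (T e) (\<lambda>t. Mker Af \<eta> j s k t * \<gamma> k t)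
        = Re (Af z0 / of_real pi * integral (T e) (F k)) + integral (T e) (N k)"
      if k: "k < m" and e: "0 < e" "e < pi" for k e
    proof -
      have F: "F k integrable_on T e"
        unfolding T_def using e by (intro integral_punctured(2) int_F k) auto
      have NT: "N k integrable_on T e"
        unfolding T_def using e by (intro integral_punctured(2) integrable_on_subinterval[OF int_N[OF k]]) auto
      have lin: "bounded_linear (\<lambda>z. Re (Af z0 / of_real pi * z))"
        by (intro bounded_linear_compose[OF bounded_linear_Re bounded_linear_mult_right])
      have "Mker Af \<eta> j s k t * \<gamma> k t = ((\<lambda>z. Re (Af z0 / of_real pi * z)) \<circ> F k) t + N k t" for t
      proof -
        have "Af z0 / of_real pi * F k t = kernel Af \<eta> j s k t * (Af (\<eta> k t) * f (\<eta> k t))"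
          using nz[OF k, of t] by (simp add: F_def kernel)
        then have "Re (Af z0 / of_real pi * F k t) = Re (kernel Af \<eta> j s k t) * Re (Af (\<eta> k t) * f (\<eta> k t))
            - Im (kernel Af \<eta> j s k t) * Im (Af (\<eta> k t) * f (\<eta> k t))"
          by (simp only: times_complex.sel(1)[of "kernel Af \<eta> j s k t"])
        then show ?thesis
          unfolding o_apply N_def Mker_def Nker_def \<mu>_def RH[OF k, symmetric] by simp
      qed
      then have "integral (T e) (\<lambda>t. Mker Af \<eta> j s k t * \<gamma> k t)
          = integral (T e) (\<lambda>t. ((\<lambda>z. Re (Af z0 / of_real pi * z)) \<circ> F k) t + N k t)"
        by (simp only:)
      also have "\<dots> = integral (T e) ((\<lambda>z. Re (Af z0 / of_real pi * z)) \<circ> F k) + integral (T e) (N k)"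
        by (rule Henstock_Kurzweil_Integration.integral_add[OF integrable_linear[OF F lin] NT])
      also have "integral (T e) ((\<lambda>z. Re (Af z0 / of_real pi * z)) \<circ> F k)
          = Re (Af z0 / of_real pi * integral (T e) (F k))"
        by (rule integral_linear[OF F lin])
      finally show ?thesis .
    qed
    obtain C \<alpha> where "\<alpha> > 0" "\<And>t. \<bar>t - s\<bar> \<le> pi \<Longrightarrow> norm (f (\<eta> j t) - f (\<eta> j s)) \<le> C * \<bar>t - s\<bar> powr \<alpha>"
      using periodic_holder_at[OF f_bdry_holder[OF j] _ s] by (metis eta_per[OF j])
    from Cauchy_principal_value_boundary[OF f_cont f_hol f_inf j s this]
    have "((\<lambda>e. \<Sum>k<m. integral (T e) (F k)) \<longlongrightarrow> of_real pi * \<i> * f z0) (at_right 0)"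
      unfolding T_def F_def z0_def .
    \<comment> \<open>The Neumann part is integrable across \<open>s\<close>, so its truncations
      tend to the full integral.\<close>
    moreover have "((\<lambda>e. \<Sum>k<m. integral (T e) (N k)) \<longlongrightarrow> Nop m Af \<eta> \<mu> j s) (at_right 0)"
      unfolding T_def Nop by (intro tendsto_sum integral_punctured_tendsto int_N) auto
    ultimately have lim: "((\<lambda>e. Re (Af z0 / of_real pi * (\<Sum>k<m. integral (T e) (F k))) + (\<Sum>k<m. integral (T e) (N k)))
        \<longlongrightarrow> Re (Af z0 / of_real pi * (of_real pi * \<i> * f z0)) + Nop m Af \<eta> \<mu> j s) (at_right 0)"
      by (intro tendsto_intros)
    \<comment> \<open>The factor \<open>\<i>\<close> of the principal value turns the real part of
      \<open>A f\<close> times \<open>\<i>\<close> into minus its imaginary part.\<close>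
    have res: "Re (Af z0 / of_real pi * (of_real pi * \<i> * f z0)) = - \<mu> j s"
    proof -
      have "Af z0 / of_real pi * (of_real pi * \<i> * f z0) = \<i> * (Af z0 * f z0)" by simp
      then show ?thesis by (simp only: Re_i_times \<mu>_def z0_def)
    qed
    have "\<forall>\<^sub>F e in at_right 0. 0 < e \<and> e < pi"
      by (auto simp: eventually_at_right_field intro: exI[of _ pi])
    then have ev: "\<forall>\<^sub>F e in at_right 0. Re (Af z0 / of_real pi * (\<Sum>k<m. integral (T e) (F k))) + (\<Sum>k<m. integral (T e) (N k))
        = Mtrunc m Af \<eta> \<gamma> j s e"
    proof eventually_elim
      case (elim e)
      then show ?case
        by (simp add: Mtrunc_def split[unfolded T_def] T_def sum_distrib_left Re_sum sum.distrib)
    qed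
    have "(Mtrunc m Af \<eta> \<gamma> j s \<longlongrightarrow> - (\<mu> j s - Nop m Af \<eta> \<mu> j s)) (at_right 0)"
      using Lim_transform_eventually[OF lim ev] unfolding res by simp
    then show "Mop_pv m Af \<eta> \<gamma> j s (- (Im (Af (\<eta> j s) * f (\<eta> j s)) -
        Nop m Af \<eta> (\<lambda>k t. Im (Af (\<eta> k t) * f (\<eta> k t))) j s))"
      unfolding Mop_pv_def \<mu>_def .
  qed
qed

end
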